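(* Let $\varepsilon>0$ be the reference Mach number, $\gamma$ the specific heat ratio, and $\Omega$ the (two-dimensional) spatial domain. Consider the first-order semi-implicit time discretization which, from $(\rho^n,\boldsymbol u^n,p^n)$ at time $t^n$, produces $(\rho^{n+1},\boldsymbol u^{n+1},p^{n+1})$ at time $t^{n+1}=t^n+\Delta t$ by $$\frac{\rho^{n+1}-\rho^n}{\Delta t}+\nabla\cdot(\rho^n\boldsymbol u^n)=0,$$ $$\frac{\boldsymbol u^{n+1}-\boldsymbol u^n}{\Delta t}+(\boldsymbol u^n\cdot\nabla)\boldsymbol u^n+\frac{\rho_{\max}^n-\rho^n}{\varepsilon^2\rho^n\rho_{\max}^n}\,\nabla p^n+\frac{1}{\varepsilon^2\rho_{\max}^n}\nabla p^{n+1}=\boldsymbol 0,$$ $$\frac{p^{n+1}-p^n}{\Delta t}+\boldsymbol u^n\cdot\nabla p^n+\gamma(p^n-p_{\min}^n)\nabla\cdot\boldsymbol u^n+\gamma p_{\min}^n\nabla\cdot\boldsymbol u^{n+1}=0,$$ where $\rho_{\max}^n:=\max_{(x,y)\in\Omega}\rho^n(x,y)$ and $p_{\min}^n:=\min_{(x,y)\in\Omega}p^n(x,y)$. Suppose that the time step is computed by $$\Delta t=K_{\rm CFL}\min\left\{\frac{\Delta x}{\max_{(x,y)\in\Omega}(|u|+\tilde c)},\ \frac{\Delta y}{\max_{(x,y)\in\Omega}(|v|+\tilde c)}\right\},\qquad \tilde c:=\frac1\varepsilon\sqrt{\gamma\,\frac{(\rho_{\max}-\rho)(p-p_{\min})}{\rho\,\rho_{\max}}},$$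 where $K_{\rm CFL}$ is a CFL number and $\Delta x,\Delta y$ are the mesh sizes of the spatial discretization. Then this time discretization is asymptotic preserving (AP) in the sense of the definition given in the context.
   Context: Primitive system. The scheme discretizes in time (space is left continuous) the non-dimensional two-dimensional compressible Euler equations in primitive variables: density $\rho(x,y,t)$, velocity $\boldsymbol u=(u,v)^\top$, pressure $p$, for $(x,y)\in\Omega$: $$\rho_t+\nabla\cdot(\rho\boldsymbol u)=0,\qquad \boldsymbol u_t+(\boldsymbol u\cdot\nabla)\boldsymbol u+\frac{1}{\varepsilon^2\rho}\nabla p=\boldsymbol 0,\qquad p_t+\boldsymbol u\cdot\nabla p+\gamma p\,\nabla\cdot\boldsymbol u=0.$$ In the time-step formula, $\rho_{\max}=\max_{(x,y)\in\Omega}\rho$ and $p_{\min}=\min_{(x,y)\in\Omega}p$. Zero-Mach-number limit. The limiting equations as $\varepsilon\to0$ are $$\rho^{(0)}_t+\nabla\cdot(\rho^{(0)}\boldsymbol u^{(0)})=0,\tag{L1}$$ $$\boldsymbol u^{(0)}_t+(\boldsymbol u^{(0)}\cdot\nabla)\boldsymbol u^{(0)}+\frac{1}{\rho^{(0)}}\nabla p^{(2)}=\boldsymbol 0,\tag{L2}$$ $$\nabla\cdot\boldsymbol u^{(0)}=0,\quad p^{(0)}\equiv\overline p_0,\tag{L3}$$ and the correct low-Mach-number scaling of the ${\cal O}(\varepsilon)$ terms is $$\nabla\cdot\boldsymbol u^{(1)}=0,\quad p^{(1)}\equiv\overline p_1,\tag{L4}$$ where $\overline p_0>0$ and $\overline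 p_1$ are constants. Definition (AP time discretization). Assume that the semi-discrete (not discretized in space) solution $(\rho^n(x,y),\boldsymbol u^n(x,y),p^n(x,y))$ at time $t^n$ can be expanded as $$\rho^n=\rho^{(0),n}+\varepsilon\rho^{(1),n}+\varepsilon^2\rho^{(2),n}+\dots,\quad \boldsymbol u^n=\boldsymbol u^{(0),n}+\varepsilon\boldsymbol u^{(1),n}+\varepsilon^2\boldsymbol u^{(2),n}+\dots,\quad p^n=p^{(0),n}+\varepsilon p^{(1),n}+\varepsilon^2p^{(2),n}+\dots,\tag{E}$$ compatibly with the asymptotic limits (L3) and (L4), that is, $$p^{(0),n}\equiv\overline p_0,\quad p^{(1),n}\equiv\overline p_1,\quad \nabla\cdot\boldsymbol u^{(0),n}=0,\quad \nabla\cdot\boldsymbol u^{(1),n}=0,$$ and assume that the Dirichlet boundary condition $$p=\overline p_0+\varepsilon\,\overline p_1+\varepsilon^2p_2+\dots\quad\text{for all }(x,y)\in\partial\Omega$$ holds, where $p_k(x,y,t)$, $k\ge2$, are bounded functions. Consider a one-step time discretization that produces at time $t^{n+1}=t^n+\Delta t$ an approximation $(\rho^{n+1},\boldsymbol u^{n+1},p^{n+1})$. Such a time discretization is called AP if it admits an asymptotic expansion of the type (E) (with $n$ replaced by $n+1$) and yields a consistent discretization of (L1)–(L4) as $\varepsilon\to0$. Asymptotic expansions are understood in the formal sense (formal power series in $\varepsilon$).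
   Formalization: Adds that Ω is bounded and connected with solvable Poisson–Dirichlet problem, the data at time n are smooth up to the boundary without vacuum, and ρ_max, p_min and Δt (finite) have expansions in powers of ε; otherwise an expansion (E) at time n+1 may fail to exist. *)

theory Defs
  imports
    "HOL-Analysis.Analysis"
    "HOL-Computational_Algebra.Formal_Laurent_Series"
    "HOL-Library.Landau_Symbols"
begin

type_synonym point = "real \<times> real"

abbreviation partial :: "'a::euclidean_space \<Rightarrow> ('a \<Rightarrow> real) \<Rightarrow> 'a \<Rightarrow> real" where
  "partial b f \<equiv> (\<lambda>z. frechet_derivative f (at z) b)"

abbreviation "px \<equiv> partial (1 :: real, 0 :: real)"
abbreviation "py \<equiv> partial (0 :: real, 1 :: real)"

primrec Ck :: "nat \<Rightarrow> 'a::euclidean_space set \<Rightarrow> ('a \<Rightarrow> real) \<Rightarrow> bool" where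
  "Ck 0 S f \<longleftrightarrow> continuous_on S f"
| "Ck (Suc k) S f \<longleftrightarrow> f differentiable_on S \<and> (\<forall>b\<in>Basis. Ck k S (partial b f))"

definition smooth_in :: "'a::euclidean_space set \<Rightarrow> ('a \<Rightarrow> real) \<Rightarrow> bool" where
  "smooth_in S f \<longleftrightarrow> (\<forall>k. Ck k S f)"

text \<open>For open \<open>S\<close>: \<open>f\<close> is \<open>C\<^sup>k\<close> in \<open>S\<close> and its derivatives up to order \<open>k\<close> extend
  continuously to the closure. Values of \<open>f\<close> outside \<open>S\<close> are irrelevant.\<close>

primrec Ck_closure :: "nat \<Rightarrow> 'a::euclidean_space set \<Rightarrow> ('a \<Rightarrow> real) \<Rightarrow> bool" where
  "Ck_closure 0 S f \<longleftrightarrow> (\<exists>g. continuous_on (closure S) g \<and> (\<forall>z\<in>S. g z = f z))"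
| "Ck_closure (Suc k) S f \<longleftrightarrow>
     (\<exists>g. continuous_on (closure S) g \<and> (\<forall>z\<in>S. g z = f z)) \<and> f differentiable_on S \<and>
     (\<forall>b\<in>Basis. Ck_closure k S (partial b f))"

text \<open>The implicit pressure update is a Dirichlet problem for the Laplacian. The following
  property makes it solvable; it holds for every bounded domain all of whose boundary points are
  regular, in particular for every bounded Lipschitz domain.\<close>

definition dirichlet_solvable :: "point set \<Rightarrow> bool" where
  "dirichlet_solvable \<Omega> \<longleftrightarrow>
     (\<forall>f g. smooth_in \<Omega> f \<and> continuous_on (closure \<Omega>) f \<and> continuous_on (frontier \<Omega>) g \<longrightarrow>
        (\<exists>\<phi>. smooth_in \<Omega> \<phi> \<and> continuous_on (closure \<Omega>) \<phi> \<and>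
             (\<forall>z\<in>\<Omega>. px (px \<phi>) z + py (py \<phi>) z = f z) \<and>
             (\<forall>z\<in>frontier \<Omega>. \<phi> z = g z)))"

text \<open>With \<open>'v = real\<close> a state is a triple of actual fields \<open>(\<rho>, (u, v), p)\<close>; with
  \<open>'v = real fps\<close> it is a formal power series in \<open>\<epsilon>\<close> whose coefficients are fields.\<close>

record 'v state =
  dens :: "point \<Rightarrow> 'v"
  velx :: "point \<Rightarrow> 'v"
  vely :: "point \<Rightarrow> 'v"
  pres :: "point \<Rightarrow> 'v"

definition expansion :: "(real \<Rightarrow> real) \<Rightarrow> real fps \<Rightarrow> bool" where
  "expansion r R \<longleftrightarrow>
     (\<forall>N. (\<lambda>e. r e - (\<Sum>k<N. fps_nth R k * e ^ k)) \<in> O[at_right 0](\<lambda>e. e ^ N))"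

definition uniform_expansion ::
    "point set \<Rightarrow> (real \<Rightarrow> point \<Rightarrow> real) \<Rightarrow> (point \<Rightarrow> real fps) \<Rightarrow> bool" where
  "uniform_expansion S f F \<longleftrightarrow>
     (\<forall>N. \<exists>C. \<forall>\<^sub>F e in at_right 0. \<forall>z\<in>S.
        \<bar>f e z - (\<Sum>k<N. fps_nth (F z) k * e ^ k)\<bar> \<le> C * e ^ N)"

definition coeff :: "nat \<Rightarrow> (point \<Rightarrow> real fps) \<Rightarrow> point \<Rightarrow> real" where
  "coeff k F = (\<lambda>z. fps_nth (F z) k)"

definition fpx :: "(point \<Rightarrow> real fps) \<Rightarrow> point \<Rightarrow> real fps" where
  "fpx F z = Abs_fps (\<lambda>k. px (coeff k F) z)"

definition fpy :: "(point \<Rightarrow> real fps) \<Rightarrow> point \<Rightarrow> real fps" where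
  "fpy F z = Abs_fps (\<lambda>k. py (coeff k F) z)"

definition compatible :: "point set \<Rightarrow> real \<Rightarrow> real \<Rightarrow> real fps state \<Rightarrow> bool" where
  "compatible \<Omega> pbar0 pbar1 F \<longleftrightarrow> (\<forall>z\<in>\<Omega>.
     coeff 0 (pres F) z = pbar0 \<and> coeff 1 (pres F) z = pbar1 \<and>
     px (coeff 0 (velx F)) z + py (coeff 0 (vely F)) z = 0 \<and>
     px (coeff 1 (velx F)) z + py (coeff 1 (vely F)) z = 0)"

definition regular_field :: "point set \<Rightarrow> (point \<Rightarrow> real) \<Rightarrow> bool" where
  "regular_field \<Omega> f \<longleftrightarrow> smooth_in \<Omega> f \<and> Ck_closure 2 \<Omega> f"

definition old_time_data ::
    "point set \<Rightarrow> real \<Rightarrow> real \<Rightarrow> (real \<Rightarrow> real state) \<Rightarrow> real fps state \<Rightarrow> bool" where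
  "old_time_data \<Omega> pbar0 pbar1 W F \<longleftrightarrow>
     (\<forall>\<^sub>F e in at_right 0.
        regular_field \<Omega> (dens (W e)) \<and> regular_field \<Omega> (velx (W e)) \<and>
        regular_field \<Omega> (vely (W e)) \<and> regular_field \<Omega> (pres (W e))) \<and>
     (\<forall>k. regular_field \<Omega> (coeff k (dens F)) \<and> regular_field \<Omega> (coeff k (velx F)) \<and>
          regular_field \<Omega> (coeff k (vely F)) \<and> regular_field \<Omega> (coeff k (pres F))) \<and>
     uniform_expansion \<Omega> (\<lambda>e. dens (W e)) (dens F) \<and>
     uniform_expansion \<Omega> (\<lambda>e. velx (W e)) (velx F) \<and>
     uniform_expansion \<Omega> (\<lambda>e. vely (W e)) (vely F) \<and>
     uniform_expansion \<Omega> (\<lambda>e. pres (W e)) (pres F) \<and>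
     (\<exists>c>0. \<forall>z\<in>\<Omega>. c \<le> coeff 0 (dens F) z) \<and>
     compatible \<Omega> pbar0 pbar1 F"

text \<open>Fields extend continuously to the compact closure of \<open>\<Omega>\<close>, so these are the maximum and
  the minimum over the closure.\<close>

definition rho_max :: "point set \<Rightarrow> real state \<Rightarrow> real" where
  "rho_max \<Omega> S = (SUP z\<in>\<Omega>. dens S z)"

definition p_min :: "point set \<Rightarrow> real state \<Rightarrow> real" where
  "p_min \<Omega> S = (INF z\<in>\<Omega>. pres S z)"

definition c_tilde :: "point set \<Rightarrow> real \<Rightarrow> real \<Rightarrow> real state \<Rightarrow> point \<Rightarrow> real" where
  "c_tilde \<Omega> \<gamma> e S z =
     1 / e * sqrt (\<gamma> * (((rho_max \<Omega> S - dens S z) * (pres S z - p_min \<Omega> S)) /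
                          (dens S z * rho_max \<Omega> S)))"

text \<open>Extended reals, so that a direction with vanishing maximal speed gives \<open>\<infinity>\<close>, i.e. no
  restriction, rather than \<open>\<Delta>x / 0 = 0\<close>.\<close>

definition cfl_time_step ::
    "point set \<Rightarrow> real \<Rightarrow> real \<Rightarrow> real \<Rightarrow> real \<Rightarrow> real \<Rightarrow> real state \<Rightarrow> ereal" where
  "cfl_time_step \<Omega> \<gamma> K \<Delta>x \<Delta>y e S =
     ereal K * min (ereal \<Delta>x / ereal (SUP z\<in>\<Omega>. \<bar>velx S z\<bar> + c_tilde \<Omega> \<gamma> e S z))
                   (ereal \<Delta>y / ereal (SUP z\<in>\<Omega>. \<bar>vely S z\<bar> + c_tilde \<Omega> \<gamma> e S z))"

text \<open>One step from \<open>F\<close> to \<open>F'\<close>, read in the field of formal Laurent series in \<open>\<epsilon> = fls_X\<close>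
  because of the factors \<open>1 / \<epsilon>\<^sup>2\<close>. \<open>R\<close>, \<open>Q\<close>, \<open>D\<close> are the series of \<open>\<rho>\<^sub>m\<^sub>a\<^sub>x\<close>, \<open>p\<^sub>m\<^sub>i\<^sub>n\<close>, \<open>\<Delta>t\<close>.\<close>

definition semi_implicit_step ::
    "point set \<Rightarrow> real \<Rightarrow> real fps \<Rightarrow> real fps \<Rightarrow> real fps \<Rightarrow>
     real fps state \<Rightarrow> real fps state \<Rightarrow> bool" where
  "semi_implicit_step \<Omega> \<gamma> R Q D F F' \<longleftrightarrow> (\<forall>z\<in>\<Omega>.
     let \<epsilon> = (fls_X :: real fls);  g = (fls_const \<gamma> :: real fls);
         dt = fps_to_fls D;  rmax = fps_to_fls R;  pmin = fps_to_fls Q;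
         r = fps_to_fls (dens F z);    r' = fps_to_fls (dens F' z);
         u = fps_to_fls (velx F z);    u' = fps_to_fls (velx F' z);
         v = fps_to_fls (vely F z);    v' = fps_to_fls (vely F' z);
         p = fps_to_fls (pres F z);    p' = fps_to_fls (pres F' z);
         u_x = fps_to_fls (fpx (velx F) z);   u_y = fps_to_fls (fpy (velx F) z);
         v_x = fps_to_fls (fpx (vely F) z);   v_y = fps_to_fls (fpy (vely F) z);
         p_x = fps_to_fls (fpx (pres F) z);   p_y = fps_to_fls (fpy (pres F) z);
         p_x' = fps_to_fls (fpx (pres F') z); p_y' = fps_to_fls (fpy (pres F') z);
         div_ru = fps_to_fls (fpx (\<lambda>w. dens F w * velx F w) z + fpy (\<lambda>w. dens F w * vely F w) z);
         div_u' = fps_to_fls (fpx (velx F') z + fpy (vely F') z)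
     in (r' - r) / dt + div_ru = 0 \<and>
        (u' - u) / dt + (u * u_x + v * u_y)
          + (rmax - r) / (\<epsilon>\<^sup>2 * r * rmax) * p_x + 1 / (\<epsilon>\<^sup>2 * rmax) * p_x' = 0 \<and>
        (v' - v) / dt + (u * v_x + v * v_y)
          + (rmax - r) / (\<epsilon>\<^sup>2 * r * rmax) * p_y + 1 / (\<epsilon>\<^sup>2 * rmax) * p_y' = 0 \<and>
        (p' - p) / dt + (u * p_x + v * p_y)
          + g * (p - pmin) * (u_x + v_y) + g * pmin * div_u' = 0)"

text \<open>Dirichlet data for the pressure at the new time level.\<close>

definition boundary_data :: "point set \<Rightarrow> real \<Rightarrow> real \<Rightarrow> (point \<Rightarrow> real fps) \<Rightarrow> bool" where
  "boundary_data \<Omega> pbar0 pbar1 B \<longleftrightarrow>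
     (\<forall>z\<in>frontier \<Omega>. coeff 0 B z = pbar0 \<and> coeff 1 B z = pbar1) \<and>
     (\<forall>k. continuous_on (frontier \<Omega>) (coeff k B) \<and> bounded (coeff k B ` frontier \<Omega>))"

definition new_time_expansion ::
    "point set \<Rightarrow> (point \<Rightarrow> real fps) \<Rightarrow> (real fps state \<Rightarrow> bool) \<Rightarrow> real fps state \<Rightarrow> bool" where
  "new_time_expansion \<Omega> B step F' \<longleftrightarrow>
     (\<forall>k. smooth_in \<Omega> (coeff k (dens F')) \<and> smooth_in \<Omega> (coeff k (velx F')) \<and>
          smooth_in \<Omega> (coeff k (vely F')) \<and> smooth_in \<Omega> (coeff k (pres F')) \<and>
          continuous_on (closure \<Omega>) (coeff k (pres F'))) \<and>
     (\<forall>z\<in>frontier \<Omega>. pres F' z = B z) \<and>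
     step F'"

record limit_state =
  rho0 :: "point \<Rightarrow> real"
  u0 :: "point \<Rightarrow> real"
  v0 :: "point \<Rightarrow> real"
  p0 :: "point \<Rightarrow> real"
  u1 :: "point \<Rightarrow> real"
  v1 :: "point \<Rightarrow> real"
  p1 :: "point \<Rightarrow> real"
  p2 :: "point \<Rightarrow> real"

definition leading_coeffs :: "real fps state \<Rightarrow> limit_state" where
  "leading_coeffs F =
     \<lparr> rho0 = coeff 0 (dens F), u0 = coeff 0 (velx F), v0 = coeff 0 (vely F),
       p0 = coeff 0 (pres F), u1 = coeff 1 (velx F), v1 = coeff 1 (vely F),
       p1 = coeff 1 (pres F), p2 = coeff 2 (pres F) \<rparr>"

type_synonym residual = "real \<times> real \<times> real \<times> real \<times> real \<times> real \<times> real"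

definition limit_system ::
    "real \<Rightarrow> real \<Rightarrow> (real \<Rightarrow> limit_state) \<Rightarrow> real \<Rightarrow> point \<Rightarrow> residual" where
  "limit_system pbar0 pbar1 \<phi> t z =
     (let L = \<phi> t in
      (deriv (\<lambda>s. rho0 (\<phi> s) z) t
         + (px (\<lambda>w. rho0 L w * u0 L w) z + py (\<lambda>w. rho0 L w * v0 L w) z),
       deriv (\<lambda>s. u0 (\<phi> s) z) t
         + (u0 L z * px (u0 L) z + v0 L z * py (u0 L) z) + 1 / rho0 L z * px (p2 L) z,
       deriv (\<lambda>s. v0 (\<phi> s) z) t
         + (u0 L z * px (v0 L) z + v0 L z * py (v0 L) z) + 1 / rho0 L z * py (p2 L) z,
       px (u0 L) z + py (v0 L) z,
       p0 L z - pbar0,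
       px (u1 L) z + py (v1 L) z,
       p1 L z - pbar1))"

definition limit_discretization ::
    "point set \<Rightarrow> real \<Rightarrow> real \<Rightarrow> real \<Rightarrow> limit_state \<Rightarrow> limit_state \<Rightarrow> point \<Rightarrow> residual" where
  "limit_discretization \<Omega> pbar0 pbar1 dt L L' z =
     (let rmax = (SUP w\<in>\<Omega>. rho0 L w) in
      ((rho0 L' z - rho0 L z) / dt
         + (px (\<lambda>w. rho0 L w * u0 L w) z + py (\<lambda>w. rho0 L w * v0 L w) z),
       (u0 L' z - u0 L z) / dt
         + (u0 L z * px (u0 L) z + v0 L z * py (u0 L) z)
         + (rmax - rho0 L z) / (rho0 L z * rmax) * px (p2 L) z + 1 / rmax * px (p2 L') z,
       (v0 L' z - v0 L z) / dt
         + (u0 L z * px (v0 L) z + v0 L z * py (v0 L) z)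
         + (rmax - rho0 L z) / (rho0 L z * rmax) * py (p2 L) z + 1 / rmax * py (p2 L') z,
       px (u0 L') z + py (v0 L') z,
       p0 L' z - pbar0,
       px (u1 L') z + py (v1 L') z,
       p1 L' z - pbar1))"

definition C1_spacetime :: "real \<Rightarrow> point set \<Rightarrow> (real \<Rightarrow> point \<Rightarrow> real) \<Rightarrow> bool" where
  "C1_spacetime T \<Omega> f \<longleftrightarrow> Ck_closure 1 ({0<..<T} \<times> \<Omega>) (\<lambda>(t, z). f t z)"

text \<open>Consistency: for every \<open>C\<^sup>1\<close> test function, not only for solutions, the discrete residual
  tends to the residual of the differential system as \<open>\<Delta>t \<rightarrow> 0\<close>, uniformly in space. In
  particular the truncation error of exact smooth solutions tends to zero.\<close>

definition consistent_discretization ::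
    "point set \<Rightarrow> real \<Rightarrow> real \<Rightarrow>
     (real \<Rightarrow> limit_state \<Rightarrow> limit_state \<Rightarrow> point \<Rightarrow> residual) \<Rightarrow> bool" where
  "consistent_discretization \<Omega> pbar0 pbar1 disc \<longleftrightarrow>
     (\<forall>T \<phi>. (\<forall>sel \<in> {rho0, u0, v0, p0, u1, v1, p1, p2}. C1_spacetime T \<Omega> (\<lambda>t. sel (\<phi> t))) \<and>
             (\<forall>t\<in>{0<..<T}. \<forall>z\<in>\<Omega>. 0 < rho0 (\<phi> t) z) \<longrightarrow>
        (\<forall>t\<in>{0<..<T}. uniform_limit \<Omega> (\<lambda>dt z. disc dt (\<phi> t) (\<phi> (t + dt)) z)
                         (limit_system pbar0 pbar1 \<phi> t) (at_right 0)))"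

text \<open>\<open>step R Q D F F'\<close> is the formal one-step relation and \<open>time_step e S\<close> the step size chosen
  from the state \<open>S\<close> at Mach number \<open>e\<close>. As the series of \<open>\<rho>\<^sub>m\<^sub>a\<^sub>x\<close>, \<open>p\<^sub>m\<^sub>i\<^sub>n\<close> and \<open>\<Delta>t\<close> enter the
  formal relation, these numbers are required to have expansions; their coefficients are not
  prescribed. The condition \<open>D\<^sub>0 > 0\<close> says that the step size does not degenerate as \<open>\<epsilon> \<rightarrow> 0\<close>.\<close>

definition asymptotic_preserving ::
    "point set \<Rightarrow> real \<Rightarrow> real \<Rightarrow> (real \<Rightarrow> real state \<Rightarrow> ereal) \<Rightarrow>
     (real fps \<Rightarrow> real fps \<Rightarrow> real fps \<Rightarrow> real fps state \<Rightarrow> real fps state \<Rightarrow> bool) \<Rightarrow>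
     (real \<Rightarrow> limit_state \<Rightarrow> limit_state \<Rightarrow> point \<Rightarrow> residual) \<Rightarrow> bool" where
  "asymptotic_preserving \<Omega> pbar0 pbar1 time_step step limit_disc \<longleftrightarrow>
     consistent_discretization \<Omega> pbar0 pbar1 limit_disc \<and>
     (\<forall>W F dt R Q D B.
        old_time_data \<Omega> pbar0 pbar1 W F \<and>
        (\<forall>\<^sub>F e in at_right 0. ereal (dt e) = time_step e (W e)) \<and>
        expansion (\<lambda>e. rho_max \<Omega> (W e)) R \<and>
        expansion (\<lambda>e. p_min \<Omega> (W e)) Q \<and>
        expansion dt D \<and>
        boundary_data \<Omega> pbar0 pbar1 B \<longrightarrow>
          0 < fps_nth D 0 \<and>
          (\<exists>F'. new_time_expansion \<Omega> B (step R Q D F) F') \<and>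
          (\<forall>F'. new_time_expansion \<Omega> B (step R Q D F) F' \<longrightarrow>
             compatible \<Omega> pbar0 pbar1 F' \<and>
             (\<forall>z\<in>\<Omega>. limit_disc (fps_nth D 0) (leading_coeffs F) (leading_coeffs F') z = 0)))"

end

theory Submission
  imports Defs
begin

text \<open>Everything follows from reading the scheme as an identity between formal power series in
  \<open>\<epsilon>\<close>, once the momentum equation has been multiplied by \<open>\<epsilon>\<^sup>2\<close>
  (\<open>semi_implicit_step_iff\<close>).

  \<^bold>\<open>The limit.\<close> The data at the old time level have a pressure that is spatially constant at the
  orders 0 and 1, so the rescaled momentum equation at these orders says that the new pressure has
  zero gradient there as well; the Dirichlet condition identifies the two constants as those of the
  old level (\<open>constant_from_boundary\<close>). As the old velocity is divergence free at these orders,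
  too, the pressure equation then reduces there to the vanishing of
  \<open>\<gamma> p\<^sub>m\<^sub>i\<^sub>n \<nabla>\<cdot>u\<close> at the new level, and since
  \<open>p\<^sub>m\<^sub>i\<^sub>n\<close> has leading coefficient \<open>pbar0 > 0\<close>, the new velocity is divergence free at both
  orders. The rescaled momentum equation at order 2 and the density equation at order 0 are the remaining
  equations of the limiting discretization (\<open>new_time_expansion_limit\<close>).

  \<^bold>\<open>Existence.\<close> Elimination of the new velocity from the pressure equation leaves an equation
  \<open>\<epsilon>\<^sup>2 p' - A \<Delta>p' = \<epsilon>\<^sup>2 G\<close>, where
  \<open>A = \<gamma> p\<^sub>m\<^sub>i\<^sub>n \<Delta>t\<^sup>2 / \<rho>\<^sub>m\<^sub>a\<^sub>x\<close> is an invertible series of constants and \<open>G\<close> is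
  computed from the old data. Its coefficients form a hierarchy of Poisson problems in which the
  right-hand side at order \<open>k + 2\<close> involves the pressure up to order \<open>k\<close> only
  (\<open>poisson_hierarchy\<close>). As \<open>G\<close> contains second derivatives of the old data, these have to
  extend continuously to the closure of the domain.

  \<^bold>\<open>The time step.\<close> The modified sound speed carries a factor \<open>1 / \<epsilon>\<close>, but
  \<open>p - p\<^sub>m\<^sub>i\<^sub>n\<close> is of order \<open>\<epsilon>\<^sup>2\<close> because the first two orders of the pressure are constant. The
  speed is therefore bounded as \<open>\<epsilon> \<rightarrow> 0\<close>, and the time step has a positive limit
  (\<open>time_step_nondegenerate\<close>).

  \<^bold>\<open>Consistency.\<close> The splitting of the pressure gradient is exact when old and new pressures
  agree, as \<open>(\<rho>\<^sub>m\<^sub>a\<^sub>x - \<rho>) / (\<rho> \<rho>\<^sub>m\<^sub>a\<^sub>x) + 1 / \<rho>\<^sub>m\<^sub>a\<^sub>x = 1 / \<rho>\<close>; the rest is uniform continuity on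
  the compact closure of the space-time cylinder (\<open>limit_discretization_consistent\<close>).\<close>

(* Throughout, $ denotes coefficients of formal power series. *)
unbundle no vec_syntax

section \<open>Continuously differentiable fields up to a larger set\<close>

lemma partial_cong:
  assumes "open S" "z \<in> S" "\<And>w. w \<in> S \<Longrightarrow> f w = g w"
  shows "partial b f z = partial b g z"
proof -
  have "(f has_derivative f') (at z) \<longleftrightarrow> (g has_derivative f') (at z)" for f'
    using has_derivative_transform_within_open[of f f' z UNIV S g, OF _ assms(1,2,3)]
      has_derivative_transform_within_open[of g f' z UNIV S f, OF _ assms(1,2) assms(3)[symmetric]]
    by blast
  then show ?thesis
    by (simp add: frechet_derivative_def)
qed

lemma differentiable_at_cong:
  assumes "open S" "z \<in> S" "\<And>w. w \<in> S \<Longrightarrow> f w = g w" "f differentiable at z"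
  shows "g differentiable at z"
  using assms(4) has_derivative_transform_within_open[of f _ z UNIV S g, OF _ assms(1-3)]
  unfolding differentiable_def by blast

lemma partial_add:
  assumes "f differentiable at z" "g differentiable at z"
  shows "partial b (\<lambda>w. f w + g w) z = partial b f z + partial b g z"
proof -
  have "((\<lambda>w. f w + g w) has_derivative
      (\<lambda>h. frechet_derivative f (at z) h + frechet_derivative g (at z) h)) (at z)"
    using assms by (intro has_derivative_add) (simp_all add: frechet_derivative_works)
  from frechet_derivative_at[OF this, symmetric] show ?thesis
    by simp
qed

lemma partial_mult:
  fixes f g :: "'a::euclidean_space \<Rightarrow> real"
  assumes "f differentiable at z" "g differentiable at z"
  shows "partial b (\<lambda>w. f w * g w) z = f z * partial b g z + partial b f z * g z"
proof -
  have "((\<lambda>w. f w * g w) has_derivative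
      (\<lambda>h. f z * frechet_derivative g (at z) h + frechet_derivative f (at z) h * g z)) (at z)"
    using assms by (intro has_derivative_mult) (simp_all add: frechet_derivative_works)
  from frechet_derivative_at[OF this, symmetric] show ?thesis
    by simp
qed

lemma partial_inverse:
  fixes f :: "'a::euclidean_space \<Rightarrow> real"
  assumes "f differentiable at z" "f z \<noteq> 0"
  shows "partial b (\<lambda>w. inverse (f w)) z = - (inverse (f z) * partial b f z * inverse (f z))"
proof -
  have "((\<lambda>w. inverse (f w)) has_derivative
      (\<lambda>h. - (inverse (f z) * frechet_derivative f (at z) h * inverse (f z)))) (at z)"
    using assms by (intro Deriv.has_derivative_inverse) (simp_all add: frechet_derivative_works)
  from frechet_derivative_at[OF this, symmetric] show ?thesis
    by simp
qed

text \<open>With \<open>T = S\<close> this is continuity on \<open>S\<close>; with \<open>T = closure S\<close> it is the condition on the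
  derivatives in \<open>Ck_closure\<close>. A common parameter \<open>T\<close> lets one set of closure lemmas serve
  interior smoothness and regularity up to the boundary.\<close>
definition extends_to :: "'a::euclidean_space set \<Rightarrow> 'a set \<Rightarrow> ('a \<Rightarrow> real) \<Rightarrow> bool" where
  "extends_to S T f \<longleftrightarrow> (\<exists>g. continuous_on T g \<and> (\<forall>z\<in>S. g z = f z))"

lemma extends_toI: "continuous_on T g \<Longrightarrow> (\<And>z. z \<in> S \<Longrightarrow> g z = f z) \<Longrightarrow> extends_to S T f"
  unfolding extends_to_def by blast

lemma extends_toE:
  assumes "extends_to S T f"
  obtains g where "continuous_on T g" "\<And>z. z \<in> S \<Longrightarrow> g z = f z"
  using assms unfolding extends_to_def by blast

lemma extends_to_const: "extends_to S T (\<lambda>z. c)"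
  by (rule extends_toI[where g = "\<lambda>z. c"]) simp_all

lemma extends_to_cong: "extends_to S T f \<Longrightarrow> (\<And>w. w \<in> S \<Longrightarrow> f w = g w) \<Longrightarrow> extends_to S T g"
  unfolding extends_to_def by simp

lemma extends_to_add:
  assumes "extends_to S T f" "extends_to S T g"
  shows "extends_to S T (\<lambda>z. f z + g z)"
proof -
  obtain f' g' where "continuous_on T f'" "\<And>z. z \<in> S \<Longrightarrow> f' z = f z"
    "continuous_on T g'" "\<And>z. z \<in> S \<Longrightarrow> g' z = g z"
    using assms extends_toE by metis
  then show ?thesis
    by (intro extends_toI[where g = "\<lambda>z. f' z + g' z"] continuous_on_add) simp_all
qed

lemma extends_to_mult:
  assumes "extends_to S T f" "extends_to S T g"
  shows "extends_to S T (\<lambda>z. f z * g z)"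
proof -
  obtain f' g' where "continuous_on T f'" "\<And>z. z \<in> S \<Longrightarrow> f' z = f z"
    "continuous_on T g'" "\<And>z. z \<in> S \<Longrightarrow> g' z = g z"
    using assms extends_toE by metis
  then show ?thesis
    by (intro extends_toI[where g = "\<lambda>z. f' z * g' z"] continuous_on_mult) simp_all
qed

text \<open>A continuous extension of \<open>f\<close> may come arbitrarily close to 0 far away from \<open>S\<close>; cutting it off
  from below at \<open>c\<close> changes no value on \<open>S\<close> and makes it invertible on \<open>T\<close>.\<close>
lemma extends_to_inverse:
  assumes "extends_to S T f" and c: "c > 0" "\<And>z. z \<in> S \<Longrightarrow> c \<le> f z"
  shows "extends_to S T (\<lambda>z. inverse (f z))"
proof -
  obtain g where g: "continuous_on T g" "\<And>z. z \<in> S \<Longrightarrow> g z = f z"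
    using assms(1) extends_toE by metis
  show ?thesis
  proof (rule extends_toI)
    have "continuous_on T (\<lambda>z. max c (g z))"
      by (intro continuous_on_max continuous_on_const g(1))
    then show "continuous_on T (\<lambda>z. inverse (max c (g z)))"
      using c(1) by (intro continuous_on_inverse) (auto simp: max_def)
    show "inverse (max c (g z)) = inverse (f z)" if "z \<in> S" for z
      using g(2) c(2)[OF that] that by (simp add: max_absorb2)
  qed
qed

primrec Ck_upto ::
    "nat \<Rightarrow> 'a::euclidean_space set \<Rightarrow> 'a set \<Rightarrow> ('a \<Rightarrow> real) \<Rightarrow> bool" where
  "Ck_upto 0 S T f \<longleftrightarrow> extends_to S T f"
| "Ck_upto (Suc k) S T f \<longleftrightarrow>
     extends_to S T f \<and> f differentiable_on S \<and> (\<forall>b\<in>Basis. Ck_upto k S T (partial b f))"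

lemma Ck_upto_closure: "Ck_upto k S (closure S) f \<longleftrightarrow> Ck_closure k S f"
  by (induction k arbitrary: f) (simp_all add: extends_to_def)

lemma Ck_upto_self: "Ck_upto k S S f \<longleftrightarrow> Ck k S f"
proof -
  have *: "extends_to S S f \<longleftrightarrow> continuous_on S f" for f :: "'a \<Rightarrow> real"
    unfolding extends_to_def using continuous_on_cong by metis
  show ?thesis
    by (induction k arbitrary: f) (auto simp: * differentiable_imp_continuous_on)
qed

lemma Ck_upto_extends: "Ck_upto k S T f \<Longrightarrow> extends_to S T f"
  by (cases k) auto

lemma Ck_upto_differentiable:
  "Ck_upto (Suc k) S T f \<Longrightarrow> open S \<Longrightarrow> z \<in> S \<Longrightarrow> f differentiable at z"
  by (simp add: differentiable_on_eq_differentiable_at)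

lemma Ck_upto_Suc_D: "Ck_upto (Suc k) S T f \<Longrightarrow> Ck_upto k S T f"
proof (induction k arbitrary: f)
  case (Suc k)
  then have "Ck_upto k S T (partial b f)" if "b \<in> Basis" for b
    using that by (metis Ck_upto.simps(2))
  with Suc.prems show ?case by simp
qed simp

lemma Ck_upto_mono: "m \<le> k \<Longrightarrow> Ck_upto k S T f \<Longrightarrow> Ck_upto m S T f"
  by (induction rule: inc_induct) (simp_all add: Ck_upto_Suc_D del: Ck_upto.simps)

lemma Ck_upto_partial: "Ck_upto (Suc k) S T f \<Longrightarrow> b \<in> Basis \<Longrightarrow> Ck_upto k S T (partial b f)"
  by simp

lemma Ck_upto_cong:
  assumes "open S" "\<And>w. w \<in> S \<Longrightarrow> f w = g w" "Ck_upto k S T f"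
  shows "Ck_upto k S T g"
  using assms(2,3)
proof (induction k arbitrary: f g)
  case 0
  then show ?case
    using extends_to_cong by (metis Ck_upto.simps(1))
next
  case (Suc k)
  have "g differentiable at w" if "w \<in> S" for w
    by (rule differentiable_at_cong[OF assms(1) that])
      (use Suc.prems(1) Ck_upto_differentiable[OF Suc.prems(2) assms(1) that] in simp_all)
  then have "g differentiable_on S"
    by (simp add: assms(1) differentiable_on_eq_differentiable_at)
  moreover have "Ck_upto k S T (partial b g)" if "b \<in> Basis" for b
    by (rule Suc.IH[OF partial_cong[OF assms(1) _ Suc.prems(1)] Ck_upto_partial[OF Suc.prems(2) that]])
  moreover have "extends_to S T g"
    using extends_to_cong[OF Ck_upto_extends[OF Suc.prems(2)] Suc.prems(1)] .
  ultimately show ?case by simp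
qed

text \<open>Product, sum and quotient rules give the partial derivatives on \<open>S\<close> only, so they may be
  replaced there by any explicit formula \<open>D\<close>.\<close>
lemma Ck_upto_SucI:
  assumes "open S" "extends_to S T f" "\<And>z. z \<in> S \<Longrightarrow> f differentiable at z"
    and "\<And>b. b \<in> Basis \<Longrightarrow> Ck_upto k S T (D b)"
    and "\<And>b z. b \<in> Basis \<Longrightarrow> z \<in> S \<Longrightarrow> D b z = partial b f z"
  shows "Ck_upto (Suc k) S T f"
proof -
  have "f differentiable_on S"
    by (simp add: assms(1,3) differentiable_on_eq_differentiable_at)
  moreover have "Ck_upto k S T (partial b f)" if "b \<in> Basis" for b
    by (rule Ck_upto_cong[OF assms(1) assms(5)[OF that] assms(4)[OF that]])
  ultimately show ?thesis
    using assms(2) by simp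
qed

lemma Ck_upto_const: "Ck_upto k S T (\<lambda>z. c)"
  by (induction k arbitrary: c) (simp_all add: extends_to_const)

lemma Ck_upto_add:
  assumes "open S" "Ck_upto k S T f" "Ck_upto k S T g"
  shows "Ck_upto k S T (\<lambda>z. f z + g z)"
  using assms(2,3)
proof (induction k arbitrary: f g)
  case 0
  then show ?case by (simp add: extends_to_add)
next
  case (Suc k)
  note diff = Ck_upto_differentiable[OF Suc.prems(1) assms(1)]
    Ck_upto_differentiable[OF Suc.prems(2) assms(1)]
  show ?case
  proof (rule Ck_upto_SucI[OF assms(1)])
    show "extends_to S T (\<lambda>z. f z + g z)"
      by (intro extends_to_add Ck_upto_extends[OF Suc.prems(1)] Ck_upto_extends[OF Suc.prems(2)])
    show "Ck_upto k S T (\<lambda>z. partial b f z + partial b g z)" if "b \<in> Basis" for b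
      by (intro Suc.IH Ck_upto_partial[OF _ that] Suc.prems)
  qed (use diff in \<open>simp_all add: partial_add differentiable_add\<close>)
qed

lemma Ck_upto_mult:
  assumes "open S" "Ck_upto k S T f" "Ck_upto k S T g"
  shows "Ck_upto k S T (\<lambda>z. f z * g z)"
  using assms(2,3)
proof (induction k arbitrary: f g)
  case 0
  then show ?case by (simp add: extends_to_mult)
next
  case (Suc k)
  note diff = Ck_upto_differentiable[OF Suc.prems(1) assms(1)]
    Ck_upto_differentiable[OF Suc.prems(2) assms(1)]
  show ?case
  proof (rule Ck_upto_SucI[OF assms(1)])
    show "extends_to S T (\<lambda>z. f z * g z)"
      by (intro extends_to_mult Ck_upto_extends[OF Suc.prems(1)] Ck_upto_extends[OF Suc.prems(2)])
    show "Ck_upto k S T (\<lambda>z. f z * partial b g z + partial b f z * g z)" if "b \<in> Basis" for b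
      by (intro Ck_upto_add[OF assms(1)] Suc.IH Ck_upto_partial[OF _ that] Suc.prems Ck_upto_Suc_D)
  qed (use diff in \<open>simp_all add: partial_mult\<close>)
qed

lemma Ck_upto_uminus:
  assumes "open S" "Ck_upto k S T f" shows "Ck_upto k S T (\<lambda>z. - f z)"
  using Ck_upto_mult[OF assms(1) Ck_upto_const[of k S T "-1"] assms(2)] by simp

lemma Ck_upto_sum:
  assumes "open S" "\<And>i. i \<in> I \<Longrightarrow> Ck_upto k S T (f i)"
  shows "Ck_upto k S T (\<lambda>z. \<Sum>i\<in>I. f i z)"
  using assms(2)
  by (induction I rule: infinite_finite_induct)
    (simp_all add: Ck_upto_const Ck_upto_add[OF assms(1)])

lemma Ck_upto_inverse:
  assumes "open S" and c: "c > 0" "\<And>z. z \<in> S \<Longrightarrow> c \<le> f z"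
    and "Ck_upto k S T f"
  shows "Ck_upto k S T (\<lambda>z. inverse (f z))"
  using assms(4)
proof (induction k)
  case 0
  then show ?case using extends_to_inverse[OF _ c] by simp
next
  case (Suc k)
  have IH: "Ck_upto k S T (\<lambda>z. inverse (f z))"
    using Suc Ck_upto_Suc_D by blast
  have nz: "f z \<noteq> 0" if "z \<in> S" for z
    using c that by force
  note diff = Ck_upto_differentiable[OF Suc.prems(1) assms(1)]
  show ?case
  proof (rule Ck_upto_SucI[OF assms(1)])
    show "extends_to S T (\<lambda>z. inverse (f z))"
      using Ck_upto_extends[OF IH] .
    show "Ck_upto k S T (\<lambda>z. - (inverse (f z) * partial b f z * inverse (f z)))"
      if "b \<in> Basis" for b
      by (intro Ck_upto_uminus Ck_upto_mult assms(1) IH Ck_upto_partial[OF _ that] Suc.prems)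
  qed (use diff nz in \<open>simp_all add: partial_inverse\<close>)
qed

lemma Ck_upto_bounded:
  assumes "Ck_upto k S (closure S) f" "bounded S"
  obtains M where "\<And>z. z \<in> S \<Longrightarrow> \<bar>f z\<bar> \<le> M"
proof -
  obtain g where g: "continuous_on (closure S) g" "\<And>z. z \<in> S \<Longrightarrow> g z = f z"
    using Ck_upto_extends[OF assms(1)] extends_toE by metis
  have "bounded (g ` closure S)"
    using assms(2) g(1) by (simp add: compact_continuous_image compact_imp_bounded)
  then obtain M where "\<forall>z\<in>closure S. \<bar>g z\<bar> \<le> M"
    by (auto simp: bounded_iff)
  then show thesis
    using g(2) closure_subset[of S] that[of M] by (metis subsetD)
qed

section \<open>Consistency of the limiting discretization\<close>

lemma uniform_limit_Pair:
  fixes f :: "'b \<Rightarrow> 'a \<Rightarrow> 'c::metric_space" and g :: "'b \<Rightarrow> 'a \<Rightarrow> 'd::metric_space"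
  assumes "uniform_limit S f l F" "uniform_limit S g m F"
  shows "uniform_limit S (\<lambda>n x. (f n x, g n x)) (\<lambda>x. (l x, m x)) F"
proof (rule uniform_limitI)
  fix e :: real assume "e > 0"
  then have "\<forall>\<^sub>F n in F. \<forall>x\<in>S. dist (f n x) (l x) < e / 2"
    "\<forall>\<^sub>F n in F. \<forall>x\<in>S. dist (g n x) (m x) < e / 2"
    using assms[THEN uniform_limitD, of "e / 2"] by simp_all
  then show "\<forall>\<^sub>F n in F. \<forall>x\<in>S. dist (f n x, g n x) (l x, m x) < e"
  proof eventually_elim
    case (elim n)
    show ?case
    proof
      fix x assume "x \<in> S"
      have "dist (f n x, g n x) (l x, m x) \<le> dist (f n x) (l x) + dist (g n x) (m x)"
        by (simp add: dist_Pair_Pair sqrt_sum_squares_le_sum)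
      also have "\<dots> < e / 2 + e / 2"
        using elim \<open>x \<in> S\<close> by (intro add_strict_mono) auto
      finally show "dist (f n x, g n x) (l x, m x) < e" by simp
    qed
  qed
qed

text \<open>A continuous function on the closed space-time cylinder is uniformly continuous, by compactness.
  This is the only source of uniformity in the consistency proof.\<close>
lemma uniform_in_space:
  fixes h :: "real \<times> point \<Rightarrow> real"
  assumes "extends_to ({0<..<T} \<times> \<Omega>) (closure ({0<..<T} \<times> \<Omega>)) h" "bounded \<Omega>"
    and "t \<in> {0<..<T}" "e > 0"
  obtains d where "d > 0" "t + d \<le> T"
    "\<And>s z. t \<le> s \<Longrightarrow> s < t + d \<Longrightarrow> z \<in> \<Omega> \<Longrightarrow> \<bar>h (s, z) - h (t, z)\<bar> < e"
proof -
  let ?Q = "{0<..<T} \<times> \<Omega>"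
  obtain g where g: "continuous_on (closure ?Q) g" "\<And>x. x \<in> ?Q \<Longrightarrow> g x = h x"
    using extends_toE[OF assms(1)] by metis
  have "compact (closure ?Q)"
    using assms(2) by (simp add: bounded_Times)
  then have "uniformly_continuous_on (closure ?Q) g"
    using compact_uniformly_continuous g(1) by blast
  then obtain d where d: "d > 0"
    "\<And>x y. x \<in> closure ?Q \<Longrightarrow> y \<in> closure ?Q \<Longrightarrow> dist y x < d \<Longrightarrow> dist (g y) (g x) < e"
    using \<open>e > 0\<close> unfolding uniformly_continuous_on_def by metis
  show thesis
  proof (rule that)
    show "min d (T - t) > 0" "t + min d (T - t) \<le> T"
      using d(1) assms(3) by auto
    fix s z assume *: "t \<le> s" "s < t + min d (T - t)" "z \<in> \<Omega>"
    then have "(s, z) \<in> ?Q" "(t, z) \<in> ?Q"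
      using assms(3) by auto
    moreover have "dist (s, z) (t, z) < d"
      using * by (simp add: dist_Pair_Pair dist_real_def)
    ultimately have "dist (g (s, z)) (g (t, z)) < e"
      by (intro d(2) closure_subset[THEN subsetD])
    then show "\<bar>h (s, z) - h (t, z)\<bar> < e"
      using g(2) \<open>(s, z) \<in> ?Q\<close> \<open>(t, z) \<in> ?Q\<close> by (simp add: dist_real_def)
  qed
qed

lemma uniform_limit_time_shift:
  fixes h :: "real \<times> point \<Rightarrow> real"
  assumes "extends_to ({0<..<T} \<times> \<Omega>) (closure ({0<..<T} \<times> \<Omega>)) h" "bounded \<Omega>"
    and "t \<in> {0<..<T}"
  shows "uniform_limit \<Omega> (\<lambda>dt z. h (t + dt, z)) (\<lambda>z. h (t, z)) (at_right 0)"
proof (rule uniform_limitI)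
  fix e :: real assume "e > 0"
  from uniform_in_space[OF assms this] obtain d where d: "d > 0"
    "\<And>s z. t \<le> s \<Longrightarrow> s < t + d \<Longrightarrow> z \<in> \<Omega> \<Longrightarrow> \<bar>h (s, z) - h (t, z)\<bar> < e"
    by metis
  have "\<forall>\<^sub>F dt in at_right 0. dt \<in> {0<..<d}"
    using d(1) by (rule eventually_at_right_real)
  then show "\<forall>\<^sub>F dt in at_right 0. \<forall>z\<in>\<Omega>. dist (h (t + dt, z)) (h (t, z)) < e"
    by eventually_elim (use d(2) in \<open>auto simp: dist_real_def\<close>)
qed

context
  fixes T :: real and \<Omega> :: "point set" and f :: "real \<Rightarrow> point \<Rightarrow> real" and h
  assumes op: "open \<Omega>" and bd: "bounded \<Omega>" and C1: "C1_spacetime T \<Omega> f"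
  defines "h \<equiv> (\<lambda>(t, z). f t z)"
begin

lemma spacetime_Ck: "Ck_upto (Suc 0) ({0<..<T} \<times> \<Omega>) (closure ({0<..<T} \<times> \<Omega>)) h"
  using C1 unfolding C1_spacetime_def h_def Ck_upto_closure One_nat_def .

lemma spacetime_has_derivative:
  assumes "t \<in> {0<..<T}" "z \<in> \<Omega>"
  shows "(h has_derivative frechet_derivative h (at (t, z))) (at (t, z))"
  using Ck_upto_differentiable[OF spacetime_Ck, of "(t, z)"] assms op
  by (simp add: open_Times frechet_derivative_works)

lemma spacetime_partial_extends:
  "b \<in> Basis \<Longrightarrow>
    extends_to ({0<..<T} \<times> \<Omega>) (closure ({0<..<T} \<times> \<Omega>)) (partial b h)"
  using Ck_upto_partial[OF spacetime_Ck] by simp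

lemma partial_time_slice:
  assumes "t \<in> {0<..<T}" "z \<in> \<Omega>"
  shows "partial b (f t) z = partial (0, b) h (t, z)"
proof -
  have "((\<lambda>w. (t, w)) has_derivative (\<lambda>v. (0, v))) (at z)"
    by (auto intro!: derivative_eq_intros)
  from has_derivative_compose[OF this spacetime_has_derivative[OF assms]]
  have "(f t has_derivative (\<lambda>v. frechet_derivative h (at (t, z)) (0, v))) (at z)"
    by (simp add: h_def)
  from frechet_derivative_at[OF this, symmetric] show ?thesis by simp
qed

lemma time_derivative_slice:
  assumes "t \<in> {0<..<T}" "z \<in> \<Omega>"
  shows "((\<lambda>s. f s z) has_real_derivative partial (1, 0) h (t, z)) (at t)"
proof -
  let ?D = "frechet_derivative h (at (t, z))"
  have D: "(h has_derivative ?D) (at (t, z))"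
    using spacetime_has_derivative[OF assms] .
  have "((\<lambda>s. (s, z)) has_derivative (\<lambda>v. (v, 0))) (at t)"
    by (auto intro!: derivative_eq_intros)
  from has_derivative_compose[OF this D]
  have *: "((\<lambda>s. f s z) has_derivative (\<lambda>v. ?D (v, 0))) (at t)"
    by (simp add: h_def)
  have "?D (v, 0) = ?D (1, 0) * v" for v
    using linear_scale[OF has_derivative_linear[OF D], of v "(1, 0)"] by simp
  then have "(\<lambda>v. ?D (v, 0)) = (*) (?D (1, 0))"
    by (rule ext)
  from subst[OF this, of "\<lambda>D'. ((\<lambda>s. f s z) has_derivative D') (at t)", OF *] show ?thesis
    unfolding has_field_derivative_def .
qed

lemma uniform_limit_value:
  assumes "t \<in> {0<..<T}"
  shows "uniform_limit \<Omega> (\<lambda>dt. f (t + dt)) (f t) (at_right 0)"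
  using uniform_limit_time_shift[OF Ck_upto_extends[OF spacetime_Ck] bd assms]
  by (simp add: h_def)

lemma uniform_limit_partial:
  assumes "t \<in> {0<..<T}" "b \<in> Basis"
  shows "uniform_limit \<Omega> (\<lambda>dt. partial b (f (t + dt))) (partial b (f t)) (at_right 0)"
proof -
  have "(0, b) \<in> (Basis :: (real \<times> point) set)"
    using assms(2) by (simp add: Basis_prod_def)
  from uniform_limit_time_shift[OF spacetime_partial_extends[OF this] bd assms(1)]
  have L: "uniform_limit \<Omega> (\<lambda>dt z. partial (0, b) h (t + dt, z))
      (\<lambda>z. partial (0, b) h (t, z)) (at_right 0)" .
  have "\<forall>\<^sub>F dt in at_right 0. dt \<in> {0<..<T - t}"
    using assms(1) by (intro eventually_at_right_real) auto
  then have "\<forall>\<^sub>F dt in at_right 0. \<forall>z\<in>\<Omega>.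
      partial (0, b) h (t + dt, z) = partial b (f (t + dt)) z"
    by eventually_elim (use assms(1) in \<open>auto simp: partial_time_slice\<close>)
  from uniform_limit_cong[THEN iffD1, OF this _ L] show ?thesis
    using partial_time_slice[OF assms(1)] by simp
qed

text \<open>By the mean value theorem the quotient is the time derivative at an intermediate time, which
  differs little from the one at \<open>t\<close>, uniformly in space.\<close>
lemma uniform_limit_difference_quotient:
  assumes "t \<in> {0<..<T}"
  shows "uniform_limit \<Omega> (\<lambda>dt z. (f (t + dt) z - f t z) / dt)
    (\<lambda>z. deriv (\<lambda>s. f s z) t) (at_right 0)"
proof (rule uniform_limitI)
  fix e :: real assume "e > 0"
  let ?g = "partial (1, 0) h"
  have "extends_to ({0<..<T} \<times> \<Omega>) (closure ({0<..<T} \<times> \<Omega>)) ?g"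
    by (rule spacetime_partial_extends) (simp add: Basis_prod_def)
  from uniform_in_space[OF this bd assms \<open>e > 0\<close>] obtain d where d: "d > 0" "t + d \<le> T"
    "\<And>s z. t \<le> s \<Longrightarrow> s < t + d \<Longrightarrow> z \<in> \<Omega> \<Longrightarrow> \<bar>?g (s, z) - ?g (t, z)\<bar> < e"
    by metis
  have "\<forall>\<^sub>F dt in at_right 0. dt \<in> {0<..<d}"
    using d(1) by (rule eventually_at_right_real)
  then show "\<forall>\<^sub>F dt in at_right 0. \<forall>z\<in>\<Omega>.
      dist ((f (t + dt) z - f t z) / dt) (deriv (\<lambda>s. f s z) t) < e"
  proof eventually_elim
    case (elim dt)
    show ?case
    proof
      fix z assume z: "z \<in> \<Omega>"
      have "((\<lambda>s. f s z) has_real_derivative ?g (s, z)) (at s)" if "t \<le> s" "s \<le> t + dt" for s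
        using time_derivative_slice[of s z] that z assms d elim by auto
      from MVT2[of t "t + dt" "\<lambda>s. f s z", OF _ this] elim
      obtain s where s: "t < s" "s < t + dt" "f (t + dt) z - f t z = dt * ?g (s, z)"
        by auto
      have "deriv (\<lambda>s. f s z) t = ?g (t, z)"
        using time_derivative_slice[OF assms z] by (rule DERIV_imp_deriv)
      moreover have "(f (t + dt) z - f t z) / dt = ?g (s, z)"
        using s(3) elim by simp
      ultimately show "dist ((f (t + dt) z - f t z) / dt) (deriv (\<lambda>s. f s z) t) < e"
        using d(3)[of s z] s elim z by (simp add: dist_real_def)
    qed
  qed
qed

lemma slice_bdd_above:
  assumes "t \<in> {0<..<T}"
  shows "bdd_above (f t ` \<Omega>)"
proof -
  have "bounded ({0<..<T} \<times> \<Omega>)"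
    using bd by (simp add: bounded_Times)
  then obtain M where M: "\<And>x. x \<in> {0<..<T} \<times> \<Omega> \<Longrightarrow> \<bar>h x\<bar> \<le> M"
    using Ck_upto_bounded[OF spacetime_Ck] by blast
  have "\<bar>f t z\<bar> \<le> M" if "z \<in> \<Omega>" for z
    using M[of "(t, z)"] assms that by (simp add: h_def)
  then show ?thesis
    by (intro bdd_aboveI2[where M = M]) (auto dest: abs_le_D1)
qed

end

text \<open>The two pressure weights add up to \<open>1 / r\<close>. The pressure gradient that varies with the time step
  is the one with the weight \<open>1 / rmax\<close>, which is constant in space; hence the convergence is
  uniform even when \<open>r\<close> comes arbitrarily close to 0.\<close>
lemma implicit_pressure_consistent:
  fixes dq :: "real \<Rightarrow> 'a \<Rightarrow> real"
  assumes "uniform_limit S dq d F" "uniform_limit S q (p :: 'a \<Rightarrow> real) F"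
    and "rmax > 0" "\<And>z. z \<in> S \<Longrightarrow> 0 < r z"
  shows "uniform_limit S
    (\<lambda>dt z. dq dt z + a z + (rmax - r z) / (r z * rmax) * p z + 1 / rmax * q dt z)
    (\<lambda>z. d z + a z + 1 / r z * p z) F"
proof -
  have "uniform_limit S
    (\<lambda>dt z. dq dt z + a z + (rmax - r z) / (r z * rmax) * p z + 1 / rmax * q dt z)
    (\<lambda>z. d z + a z + (rmax - r z) / (r z * rmax) * p z + 1 / rmax * p z) F"
    by (intro uniform_limit_add uniform_limit_const assms(1)
        bounded_linear.uniform_limit[OF bounded_linear_mult_right assms(2)])
  moreover have "d z + a z + (rmax - r z) / (r z * rmax) * p z + 1 / rmax * p z
      = d z + a z + 1 / r z * p z" if "z \<in> S" for z
    using assms(3) assms(4)[OF that] by (simp add: field_simps)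
  ultimately show ?thesis
    using uniform_limit_cong'[of S _ _
      "\<lambda>z. d z + a z + (rmax - r z) / (r z * rmax) * p z + 1 / rmax * p z"
      "\<lambda>z. d z + a z + 1 / r z * p z" F] by blast
qed

lemma limit_discretization_consistent:
  assumes "open \<Omega>" "bounded \<Omega>" "\<Omega> \<noteq> {}"
  shows "consistent_discretization \<Omega> pbar0 pbar1 (limit_discretization \<Omega> pbar0 pbar1)"
  unfolding consistent_discretization_def
proof (intro allI impI ballI)
  fix T t :: real and \<phi> :: "real \<Rightarrow> limit_state"
  assume H: "(\<forall>sel \<in> {rho0, u0, v0, p0, u1, v1, p1, p2}. C1_spacetime T \<Omega> (\<lambda>t. sel (\<phi> t))) \<and>
    (\<forall>t\<in>{0<..<T}. \<forall>z\<in>\<Omega>. 0 < rho0 (\<phi> t) z)"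
    and t: "t \<in> {0<..<T}"
  define rmax where "rmax = (SUP w\<in>\<Omega>. rho0 (\<phi> t) w)"
  obtain w where w: "w \<in> \<Omega>" using assms(3) by blast
  have pos: "\<And>z. z \<in> \<Omega> \<Longrightarrow> 0 < rho0 (\<phi> t) z"
    using H t by blast
  have "rho0 (\<phi> t) w \<le> rmax"
    unfolding rmax_def using w slice_bdd_above[OF assms(1,2) _ t, of "\<lambda>t. rho0 (\<phi> t)"] H
    by (intro cSUP_upper) auto
  then have rmax: "rmax > 0"
    using pos[OF w] by simp
  have B: "(1, 0) \<in> (Basis :: point set)" "(0, 1) \<in> (Basis :: point set)"
    by (simp_all add: Basis_prod_def)
  have C: "C1_spacetime T \<Omega> (\<lambda>t. rho0 (\<phi> t))" "C1_spacetime T \<Omega> (\<lambda>t. u0 (\<phi> t))"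
    "C1_spacetime T \<Omega> (\<lambda>t. v0 (\<phi> t))" "C1_spacetime T \<Omega> (\<lambda>t. p0 (\<phi> t))"
    "C1_spacetime T \<Omega> (\<lambda>t. u1 (\<phi> t))" "C1_spacetime T \<Omega> (\<lambda>t. v1 (\<phi> t))"
    "C1_spacetime T \<Omega> (\<lambda>t. p1 (\<phi> t))" "C1_spacetime T \<Omega> (\<lambda>t. p2 (\<phi> t))"
    using H by blast+
  note dq = uniform_limit_difference_quotient[OF assms(1,2) _ t]
    and val = uniform_limit_value[OF assms(1,2) _ t]
    and sx = uniform_limit_partial[OF assms(1,2) _ t B(1)]
    and sy = uniform_limit_partial[OF assms(1,2) _ t B(2)]
  show "uniform_limit \<Omega> (\<lambda>dt z. limit_discretization \<Omega> pbar0 pbar1 dt (\<phi> t) (\<phi> (t + dt)) z)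
      (limit_system pbar0 pbar1 \<phi> t) (at_right 0)"
    unfolding limit_discretization_def limit_system_def[abs_def] Let_def rmax_def[symmetric]
    by (intro uniform_limit_Pair implicit_pressure_consistent uniform_limit_add
        uniform_limit_minus uniform_limit_const dq val sx sy C rmax pos)
qed

section \<open>Fields of formal power series and the rescaled scheme\<close>

lemma smooth_in_iff: "smooth_in S f \<longleftrightarrow> (\<forall>k. Ck_upto k S S f)"
  by (simp add: smooth_in_def Ck_upto_self)

text \<open>The direction is a parameter, so that \<open>fpx\<close> and \<open>fpy\<close> need not be treated separately.\<close>
definition fpartial :: "point \<Rightarrow> (point \<Rightarrow> real fps) \<Rightarrow> point \<Rightarrow> real fps" where
  "fpartial b F z = Abs_fps (\<lambda>k. partial b (coeff k F) z)"

lemma fpx_eq: "fpx = fpartial (1, 0)" and fpy_eq: "fpy = fpartial (0, 1)"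
  by (simp_all add: fun_eq_iff fpx_def fpy_def fpartial_def)

definition field_Ck :: "nat \<Rightarrow> point set \<Rightarrow> point set \<Rightarrow> (point \<Rightarrow> real fps) \<Rightarrow> bool" where
  "field_Ck k S T F \<longleftrightarrow> (\<forall>n. Ck_upto k S T (coeff n F))"

lemma field_CkD: "field_Ck k S T F \<Longrightarrow> Ck_upto k S T (coeff n F)"
  by (simp add: field_Ck_def)

lemma field_Ck_mono: "m \<le> k \<Longrightarrow> field_Ck k S T F \<Longrightarrow> field_Ck m S T F"
  unfolding field_Ck_def using Ck_upto_mono by blast

lemma field_Ck_const: "field_Ck k S T (\<lambda>z. C)"
  by (simp add: field_Ck_def coeff_def Ck_upto_const)

lemma field_Ck_add:
  "open S \<Longrightarrow> field_Ck k S T F \<Longrightarrow> field_Ck k S T G \<Longrightarrow> field_Ck k S T (\<lambda>z. F z + G z)"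
  by (simp add: field_Ck_def coeff_def Ck_upto_add)

lemma field_Ck_mult:
  "open S \<Longrightarrow> field_Ck k S T F \<Longrightarrow> field_Ck k S T G \<Longrightarrow> field_Ck k S T (\<lambda>z. F z * G z)"
  by (simp add: field_Ck_def coeff_def fps_mult_nth Ck_upto_mult Ck_upto_sum)

lemma field_Ck_diff:
  assumes "open S" "field_Ck k S T F" "field_Ck k S T G"
  shows "field_Ck k S T (\<lambda>z. F z - G z)"
  using field_Ck_add[OF assms(1,2) field_Ck_mult[OF assms(1) field_Ck_const[of k S T "-1"] assms(3)]]
  by simp

lemma field_Ck_shift: "field_Ck k S T F \<Longrightarrow> field_Ck k S T (\<lambda>z. fps_shift m (F z))"
  by (simp add: field_Ck_def coeff_def)

lemma field_Ck_fpartial: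
  "field_Ck (Suc k) S T F \<Longrightarrow> b \<in> Basis \<Longrightarrow> field_Ck k S T (fpartial b F)"
  by (simp add: field_Ck_def coeff_def fpartial_def)

text \<open>The coefficients of the reciprocal satisfy the recursion that comes from
  \<open>inverse F * F = 1\<close>; the sole division in it is by the leading coefficient.\<close>
lemma field_Ck_inverse:
  assumes "open S" and c: "c > 0" "\<And>z. z \<in> S \<Longrightarrow> c \<le> coeff 0 F z"
    and F: "field_Ck k S T F"
  shows "field_Ck k S T (\<lambda>z. inverse (F z))"
  unfolding field_Ck_def
proof
  let ?I = "\<lambda>n z. inverse (F z) $ n"
  fix n
  have "Ck_upto k S T (?I n)"
  proof (induction n rule: less_induct)
    case (less n)
    have rec: "inverse (F z $ 0) * ((if n = 0 then 1 else 0) - (\<Sum>i<n. ?I i z * F z $ (n - i)))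
      = ?I n z" if "z \<in> S" for z
    proof -
      have nz: "F z $ 0 \<noteq> 0"
        using c(1) c(2)[OF that] by (simp add: coeff_def)
      have "(inverse (F z) * F z) $ n = (\<Sum>i<n. ?I i z * F z $ (n - i)) + ?I n z * F z $ 0"
        by (simp add: fps_mult_nth atLeast0AtMost lessThan_Suc_atMost[symmetric])
      moreover have "(inverse (F z) * F z) $ n = (if n = 0 then 1 else 0)"
        by (simp add: inverse_mult_eq_1[OF nz])
      ultimately show ?thesis
        using nz by (simp add: field_simps)
    qed
    have "Ck_upto k S T (\<lambda>z. inverse (F z $ 0) *
        ((if n = 0 then 1 else 0) + - (\<Sum>i<n. ?I i z * F z $ (n - i))))"
      using F[unfolded field_Ck_def coeff_def] c[unfolded coeff_def] less.IH
      by (intro Ck_upto_mult Ck_upto_add Ck_upto_uminus Ck_upto_sum Ck_upto_const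
          Ck_upto_inverse[where c = c] assms(1)) auto
    then show ?case
      by (rule Ck_upto_cong[OF assms(1), rotated]) (use rec in simp)
  qed
  then show "Ck_upto k S T (coeff n (\<lambda>z. inverse (F z)))"
    by (simp add: coeff_def)
qed

lemma partial_cmult:
  "f differentiable at z \<Longrightarrow> partial b (\<lambda>w. c * f w) z = c * partial b f z"
  using partial_mult[of "\<lambda>w. c" z f b] by simp

lemma partial_sum:
  assumes "\<And>i. i \<in> I \<Longrightarrow> f i differentiable at z"
  shows "partial b (\<lambda>w. \<Sum>i\<in>I. f i w) z = (\<Sum>i\<in>I. partial b (f i) z)"
proof -
  have "((\<lambda>w. \<Sum>i\<in>I. f i w) has_derivative (\<lambda>h. \<Sum>i\<in>I. frechet_derivative (f i) (at z) h)) (at z)"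
    using assms by (intro has_derivative_sum) (simp add: frechet_derivative_works)
  from frechet_derivative_at[OF this, symmetric] show ?thesis
    by simp
qed

lemma fpartial_cmult:
  assumes "\<And>n. coeff n F differentiable at z"
  shows "fpartial b (\<lambda>w. C * F w) z = C * fpartial b F z"
proof (rule fps_ext)
  fix n
  have d: "(\<lambda>w. F w $ m) differentiable at z" for m
    using assms by (simp add: coeff_def)
  then show "fpartial b (\<lambda>w. C * F w) z $ n = (C * fpartial b F z) $ n"
    by (simp add: fpartial_def coeff_def fps_mult_nth partial_sum partial_cmult)
qed

lemma fpartial_diff:
  assumes "\<And>n. coeff n F differentiable at z" "\<And>n. coeff n G differentiable at z"
  shows "fpartial b (\<lambda>w. F w - G w) z = fpartial b F z - fpartial b G z"
proof (rule fps_ext)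
  fix n
  have "partial b (\<lambda>w. (- 1) * G w $ n) z = (- 1) * partial b (\<lambda>w. G w $ n) z"
    by (rule partial_cmult) (use assms(2)[of n] in \<open>simp add: coeff_def\<close>)
  then have "partial b (\<lambda>w. F w $ n + - (G w $ n)) z
      = partial b (\<lambda>w. F w $ n) z + - partial b (\<lambda>w. G w $ n) z"
    using assms[of n] by (subst partial_add) (simp_all add: coeff_def)
  then show "fpartial b (\<lambda>w. F w - G w) z $ n = (fpartial b F z - fpartial b G z) $ n"
    by (simp add: fpartial_def coeff_def)
qed

lemma fps_to_fls_inverse:
  fixes f :: "real fps"
  assumes "f $ 0 \<noteq> 0"
  shows "inverse (fps_to_fls f) = fps_to_fls (inverse f)"
  using assms by (intro fls_inverse_fps_to_fls) simp

lemma mass_update_iff: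
  fixes D :: "real fps"
  assumes "D $ 0 \<noteq> 0"
  shows "(fps_to_fls r' - fps_to_fls r) / fps_to_fls D + fps_to_fls d = 0 \<longleftrightarrow> r' = r - D * d"
proof -
  have "fps_to_fls D \<noteq> 0" using assms by auto
  then have "(fps_to_fls r' - fps_to_fls r) / fps_to_fls D + fps_to_fls d = 0 \<longleftrightarrow>
      fps_to_fls r' = fps_to_fls (r - D * d)"
    by (simp add: field_simps fls_times_fps_to_fls add_eq_0_iff eq_diff_eq)
  then show ?thesis by (simp only: fps_to_fls_eq_iff)
qed

text \<open>The identity is stated in an arbitrary field with a generic \<open>X\<close>, so that it can be used for
  Laurent series, where \<open>X\<close> is the series \<open>\<epsilon>\<close>.\<close>
lemma momentum_rescaled:
  fixes X :: "'a::field"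
  assumes "X \<noteq> 0" "d \<noteq> 0" "r \<noteq> 0" "R \<noteq> 0"
  shows "X\<^sup>2 * ((w' - w) * inverse d + a) + (inverse r - inverse R) * q + inverse R * q'
    = X\<^sup>2 * ((w' - w) / d + a + (R - r) / (X\<^sup>2 * r * R) * q + 1 / (X\<^sup>2 * R) * q')"
  using assms by (simp add: field_simps)

lemma momentum_update_iff:
  fixes D R r a w w' q q' :: "real fps"
  assumes "D $ 0 \<noteq> 0" "R $ 0 \<noteq> 0" "r $ 0 \<noteq> 0"
  shows "(fps_to_fls w' - fps_to_fls w) / fps_to_fls D + fps_to_fls a
      + (fps_to_fls R - fps_to_fls r) / (fls_X\<^sup>2 * fps_to_fls r * fps_to_fls R) * fps_to_fls q
      + 1 / (fls_X\<^sup>2 * fps_to_fls R) * fps_to_fls q' = 0 \<longleftrightarrow>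
    fps_X\<^sup>2 * ((w' - w) * inverse D + a) + (inverse r - inverse R) * q + inverse R * q' = 0"
    (is "?L = 0 \<longleftrightarrow> ?E = 0")
proof -
  have nz: "fps_to_fls D \<noteq> 0" "fps_to_fls R \<noteq> 0" "fps_to_fls r \<noteq> 0" "(fls_X :: real fls) \<noteq> 0"
    using assms by auto
  have "fps_to_fls ?E = fls_X\<^sup>2 * ?L"
    unfolding momentum_rescaled[OF nz(4,1,3,2), symmetric]
    by (simp add: fls_times_fps_to_fls fps_to_fls_power fps_to_fls_inverse assms)
  then show ?thesis
    using nz(4) by (metis fps_to_fls_eq_0_iff mult_eq_0_iff power_not_zero)
qed

lemma pressure_update_iff:
  fixes D p p' q :: "real fps"
  assumes "D $ 0 \<noteq> 0"
  shows "(fps_to_fls p' - fps_to_fls p) / fps_to_fls D + fps_to_fls q = 0 \<longleftrightarrow>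
    (p' - p) * inverse D + q = 0"
proof -
  have "(fps_to_fls p' - fps_to_fls p) / fps_to_fls D + fps_to_fls q
      = fps_to_fls ((p' - p) * inverse D + q)"
    by (simp add: divide_inverse fps_to_fls_inverse[OF assms] fls_times_fps_to_fls)
  then show ?thesis by (simp only: fps_to_fls_eq_0_iff)
qed

text \<open>All series that occur in denominators have a nonzero constant term, apart from the explicit
  \<open>\<epsilon>\<^sup>2\<close>. Multiplication by \<open>\<epsilon>\<^sup>2\<close> thus turns the step into equations between power series.\<close>
lemma semi_implicit_step_iff:
  assumes "D $ 0 \<noteq> 0" "R $ 0 \<noteq> 0" "\<And>z. z \<in> \<Omega> \<Longrightarrow> dens F z $ 0 \<noteq> 0"
  shows "semi_implicit_step \<Omega> \<gamma> R Q D F F' \<longleftrightarrow> (\<forall>z\<in>\<Omega>.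
    dens F' z = dens F z - D * (fpx (\<lambda>w. dens F w * velx F w) z + fpy (\<lambda>w. dens F w * vely F w) z) \<and>
    fps_X\<^sup>2 * ((velx F' z - velx F z) * inverse D
        + (velx F z * fpx (velx F) z + vely F z * fpy (velx F) z))
      + (inverse (dens F z) - inverse R) * fpx (pres F) z + inverse R * fpx (pres F') z = 0 \<and>
    fps_X\<^sup>2 * ((vely F' z - vely F z) * inverse D
        + (velx F z * fpx (vely F) z + vely F z * fpy (vely F) z))
      + (inverse (dens F z) - inverse R) * fpy (pres F) z + inverse R * fpy (pres F') z = 0 \<and>
    (pres F' z - pres F z) * inverse D
      + (velx F z * fpx (pres F) z + vely F z * fpy (pres F) z
        + fps_const \<gamma> * (pres F z - Q) * (fpx (velx F) z + fpy (vely F) z)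
        + fps_const \<gamma> * Q * (fpx (velx F') z + fpy (vely F') z)) = 0)"
  unfolding semi_implicit_step_def Let_def
proof (rule ball_cong[OF refl], goal_cases)
  case (1 z)
  then have z: "z \<in> \<Omega>" .
  note D = assms(1) and nz = assms(1,2) assms(3)[OF z]
  note mass = mass_update_iff[OF D, of "dens F' z" "dens F z"
      "fpx (\<lambda>w. dens F w * velx F w) z + fpy (\<lambda>w. dens F w * vely F w) z"]
    and mx = momentum_update_iff[OF nz, of "velx F' z" "velx F z"
      "velx F z * fpx (velx F) z + vely F z * fpy (velx F) z" "fpx (pres F) z" "fpx (pres F') z"]
    and my = momentum_update_iff[OF nz, of "vely F' z" "vely F z"
      "velx F z * fpx (vely F) z + vely F z * fpy (vely F) z" "fpy (pres F) z" "fpy (pres F') z"]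
    and p = pressure_update_iff[OF D, of "pres F' z" "pres F z"
      "velx F z * fpx (pres F) z + vely F z * fpy (pres F) z
        + fps_const \<gamma> * (pres F z - Q) * (fpx (velx F) z + fpy (vely F) z)
        + fps_const \<gamma> * Q * (fpx (velx F') z + fpy (vely F') z)"]
  show ?case
    unfolding mass[symmetric] mx[symmetric] my[symmetric] p[symmetric]
    by (simp only: fls_times_fps_to_fls fps_to_fls_plus fps_to_fls_minus fps_const_to_fls add.assoc)
qed

section \<open>Leading orders of the maximal density, the minimal pressure and the time step\<close>

lemma SUP_close:
  fixes f l :: "'a \<Rightarrow> real"
  assumes "S \<noteq> {}" "bdd_above (l ` S)" "\<And>z. z \<in> S \<Longrightarrow> \<bar>f z - l z\<bar> \<le> d"
  shows "\<bar>(SUP z\<in>S. f z) - (SUP z\<in>S. l z)\<bar> \<le> d"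
proof -
  have l: "l z \<le> (SUP z\<in>S. l z)" if "z \<in> S" for z
    using assms(2) that by (rule cSUP_upper2) simp
  have upper: "f z \<le> (SUP z\<in>S. l z) + d" if "z \<in> S" for z
    using l[OF that] assms(3)[OF that] by linarith
  then have "bdd_above (f ` S)"
    by (rule bdd_aboveI2)
  then have f: "f z \<le> (SUP z\<in>S. f z)" if "z \<in> S" for z
    using that by (rule cSUP_upper2) simp
  have "(SUP z\<in>S. f z) \<le> (SUP z\<in>S. l z) + d"
    using upper by (intro cSUP_least[OF assms(1)])
  moreover have "(SUP z\<in>S. l z) \<le> (SUP z\<in>S. f z) + d"
    using f assms(3) by (intro cSUP_least[OF assms(1)]) (smt (verit))
  ultimately show ?thesis by linarith
qed

lemma INF_close:
  fixes f :: "'a \<Rightarrow> real"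
  assumes "S \<noteq> {}" "\<And>z. z \<in> S \<Longrightarrow> \<bar>f z - a\<bar> \<le> d"
  shows "\<bar>(INF z\<in>S. f z) - a\<bar> \<le> d" "\<And>z. z \<in> S \<Longrightarrow> (INF z\<in>S. f z) \<le> f z"
proof -
  have lower: "a - d \<le> f z" if "z \<in> S" for z
    using assms(2)[OF that] by linarith
  then have "bdd_below (f ` S)"
    by (rule bdd_belowI2)
  then show f: "(INF z\<in>S. f z) \<le> f z" if "z \<in> S" for z
    using that by (rule cINF_lower)
  obtain w where "w \<in> S" using assms(1) by blast
  have "a - d \<le> (INF z\<in>S. f z)"
    using lower by (rule cINF_greatest[OF assms(1)])
  with f[OF \<open>w \<in> S\<close>] assms(2)[OF \<open>w \<in> S\<close>] show "\<bar>(INF z\<in>S. f z) - a\<bar> \<le> d"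
    by linarith
qed

lemma expansion_tendsto:
  assumes "expansion r R"
  shows "(r \<longlongrightarrow> R $ 0) (at_right 0)"
proof -
  have "(\<lambda>e. r e - R $ 0) \<in> O[at_right 0](\<lambda>e. e ^ 1)"
    using assms[unfolded expansion_def, rule_format, of 1] by simp
  then obtain c where "\<forall>\<^sub>F e in at_right 0. norm (r e - R $ 0) \<le> c * norm (e ^ 1 :: real)"
    by (elim landau_o.bigE)
  then have "\<forall>\<^sub>F e in at_right 0. norm (r e - R $ 0) \<le> c * \<bar>e\<bar>"
    by simp
  moreover have "((\<lambda>e. c * \<bar>e\<bar>) \<longlongrightarrow> 0) (at_right (0::real))"
    by (auto intro!: tendsto_eq_intros)
  ultimately have "((\<lambda>e. r e - R $ 0) \<longlongrightarrow> 0) (at_right 0)"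
    by (rule Lim_null_comparison)
  then show ?thesis
    by (simp add: LIM_zero_iff)
qed

lemma uniform_expansion_limit:
  assumes "uniform_expansion S f F"
  shows "uniform_limit S f (coeff 0 F) (at_right 0)"
proof (rule uniform_limitI)
  fix d :: real assume "d > 0"
  obtain C where C: "\<forall>\<^sub>F e in at_right 0. \<forall>z\<in>S. \<bar>f e z - coeff 0 F z\<bar> \<le> C * e"
    using assms[unfolded uniform_expansion_def, rule_format, of 1] by (auto simp: coeff_def)
  have "((\<lambda>e. C * e) \<longlongrightarrow> 0) (at_right (0::real))"
    by (auto intro!: tendsto_eq_intros)
  then have "\<forall>\<^sub>F e in at_right 0. C * e < d"
    using \<open>d > 0\<close> by (rule order_tendstoD(2))
  with C show "\<forall>\<^sub>F e in at_right 0. \<forall>z\<in>S. dist (f e z) (coeff 0 F z) < d"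
    by eventually_elim (force simp: dist_real_def)
qed

lemma regular_field_Ck: "regular_field \<Omega> f \<Longrightarrow> Ck_upto 2 \<Omega> (closure \<Omega>) f"
  by (simp add: regular_field_def Ck_upto_closure)

lemma uniform_expansion_bounded:
  assumes "uniform_expansion \<Omega> f F" "regular_field \<Omega> (coeff 0 F)" "bounded \<Omega>"
  obtains M where "\<forall>\<^sub>F e in at_right 0. \<forall>z\<in>\<Omega>. \<bar>f e z\<bar> \<le> M"
proof -
  obtain M where M: "\<And>z. z \<in> \<Omega> \<Longrightarrow> \<bar>coeff 0 F z\<bar> \<le> M"
    using Ck_upto_bounded[OF regular_field_Ck[OF assms(2)] assms(3)] by blast
  have "\<forall>\<^sub>F e in at_right 0. \<forall>z\<in>\<Omega>. dist (f e z) (coeff 0 F z) < 1"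
    using uniform_limitD[OF uniform_expansion_limit[OF assms(1)]] by simp
  then have "\<forall>\<^sub>F e in at_right 0. \<forall>z\<in>\<Omega>. \<bar>f e z\<bar> \<le> M + 1"
  proof eventually_elim
    case (elim e)
    show ?case
    proof
      fix z assume "z \<in> \<Omega>"
      with elim M[OF this] show "\<bar>f e z\<bar> \<le> M + 1"
        by (fastforce simp: dist_real_def)
    qed
  qed
  then show thesis by (rule that)
qed

text \<open>The bound does not depend on \<open>e\<close>: the prefactor \<open>1 / e\<close> is compensated by the square root of
  the pressure variation, which is of order \<open>e\<^sup>2\<close>. Moreover \<open>(rmax - r) / rmax\<close> is at most 1.\<close>
lemma c_tilde_bound:
  assumes "0 < e" "0 < \<gamma>" "0 < b" "z \<in> \<Omega>" "b \<le> dens S z" "dens S z \<le> rho_max \<Omega> S"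
    and "p_min \<Omega> S \<le> pres S z" "pres S z - p_min \<Omega> S \<le> C * e\<^sup>2"
  shows "0 \<le> c_tilde \<Omega> \<gamma> e S z" "c_tilde \<Omega> \<gamma> e S z \<le> sqrt (\<gamma> * (C / b))"
proof -
  define r rm q where "r = dens S z" and "rm = rho_max \<Omega> S" and "q = pres S z - p_min \<Omega> S"
  have *: "0 < r" "b \<le> r" "r \<le> rm" "0 \<le> q" "q \<le> C * e\<^sup>2"
    using assms by (simp_all add: r_def rm_def q_def)
  have eq: "c_tilde \<Omega> \<gamma> e S z = 1 / e * sqrt (\<gamma> * (((rm - r) * q) / (r * rm)))"
    by (simp add: c_tilde_def r_def rm_def q_def)
  show "0 \<le> c_tilde \<Omega> \<gamma> e S z"
    unfolding eq using * assms(1,2) by simp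
  have "((rm - r) * q) / (r * rm) = ((rm - r) / rm) * (q / r)"
    by simp
  also have "\<dots> \<le> 1 * (q / r)"
    using * by (intro mult_right_mono) simp_all
  also have "\<dots> \<le> (C * e\<^sup>2) / b"
    using * assms(3) by (simp add: frac_le)
  finally have "\<gamma> * (((rm - r) * q) / (r * rm)) \<le> (\<gamma> * (C / b)) * e\<^sup>2"
    using mult_left_mono[of _ _ \<gamma>] assms(2) by fastforce
  then have "sqrt (\<gamma> * (((rm - r) * q) / (r * rm))) \<le> sqrt (\<gamma> * (C / b)) * e"
    using assms(1) by (metis abs_of_pos real_sqrt_abs real_sqrt_le_mono real_sqrt_mult)
  then show "c_tilde \<Omega> \<gamma> e S z \<le> sqrt (\<gamma> * (C / b))"
    unfolding eq using assms(1) by (simp add: field_simps)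
qed

lemma ereal_divide_lower:
  assumes "0 < a" "0 \<le> s" "s \<le> M" "0 < M"
  shows "ereal (a / M) \<le> ereal a / ereal s"
  using assms by (cases "s = 0") (simp_all add: frac_le)

lemma cfl_time_step_lower:
  assumes "\<Omega> \<noteq> {}" "0 < K" "0 < \<Delta>x" "0 < \<Delta>y" "0 < M"
    and "\<And>z. z \<in> \<Omega> \<Longrightarrow> 0 \<le> c_tilde \<Omega> \<gamma> e S z"
    and "\<And>z. z \<in> \<Omega> \<Longrightarrow> \<bar>velx S z\<bar> + c_tilde \<Omega> \<gamma> e S z \<le> M"
    and "\<And>z. z \<in> \<Omega> \<Longrightarrow> \<bar>vely S z\<bar> + c_tilde \<Omega> \<gamma> e S z \<le> M"
  shows "ereal (K * min (\<Delta>x / M) (\<Delta>y / M)) \<le> cfl_time_step \<Omega> \<gamma> K \<Delta>x \<Delta>y e S"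
proof -
  have sup: "0 \<le> (SUP z\<in>\<Omega>. f z)" "(SUP z\<in>\<Omega>. f z) \<le> M"
    if "\<And>z. z \<in> \<Omega> \<Longrightarrow> 0 \<le> f z" "\<And>z. z \<in> \<Omega> \<Longrightarrow> f z \<le> M" for f :: "point \<Rightarrow> real"
  proof -
    obtain w where "w \<in> \<Omega>" using assms(1) by blast
    then show "0 \<le> (SUP z\<in>\<Omega>. f z)"
      using that by (intro cSUP_upper2[of f \<Omega> w 0] bdd_aboveI2[where M = M])
    show "(SUP z\<in>\<Omega>. f z) \<le> M"
      using that(2) by (rule cSUP_least[OF assms(1)])
  qed
  have "ereal (min (\<Delta>x / M) (\<Delta>y / M)) \<le>
      min (ereal \<Delta>x / ereal (SUP z\<in>\<Omega>. \<bar>velx S z\<bar> + c_tilde \<Omega> \<gamma> e S z))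
          (ereal \<Delta>y / ereal (SUP z\<in>\<Omega>. \<bar>vely S z\<bar> + c_tilde \<Omega> \<gamma> e S z))"
    unfolding ereal_min
    by (intro min.mono ereal_divide_lower sup assms(3-5)) (simp_all add: assms(6-8))
  then have "ereal K * ereal (min (\<Delta>x / M) (\<Delta>y / M)) \<le> cfl_time_step \<Omega> \<gamma> K \<Delta>x \<Delta>y e S"
    unfolding cfl_time_step_def using assms(2) by (intro ereal_mult_left_mono) simp_all
  then show ?thesis by (simp only: times_ereal.simps(1))
qed

context
  fixes \<Omega> :: "point set" and pbar0 pbar1 :: real
    and W :: "real \<Rightarrow> real state" and F :: "real fps state"
  assumes dom: "open \<Omega>" "bounded \<Omega>" "\<Omega> \<noteq> {}"
    and old: "old_time_data \<Omega> pbar0 pbar1 W F"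
begin

lemma old_pressure_expansion:
  obtains C where "C > 0"
    "\<forall>\<^sub>F e in at_right 0. \<forall>z\<in>\<Omega>. \<bar>pres (W e) z - (pbar0 + pbar1 * e)\<bar> \<le> C * e\<^sup>2"
proof -
  have c: "coeff 0 (pres F) z = pbar0" "coeff 1 (pres F) z = pbar1" if "z \<in> \<Omega>" for z
    using old that by (auto simp: old_time_data_def compatible_def)
  have "uniform_expansion \<Omega> (\<lambda>e. pres (W e)) (pres F)"
    using old by (simp add: old_time_data_def)
  from this[unfolded uniform_expansion_def, rule_format, of 2] obtain C where
    "\<forall>\<^sub>F e in at_right 0. \<forall>z\<in>\<Omega>.
      \<bar>pres (W e) z - (\<Sum>k<2. fps_nth (pres F z) k * e ^ k)\<bar> \<le> C * e\<^sup>2" ..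
  then have "\<forall>\<^sub>F e in at_right 0. \<forall>z\<in>\<Omega>. \<bar>pres (W e) z - (pbar0 + pbar1 * e)\<bar> \<le> max C 1 * e\<^sup>2"
  proof eventually_elim
    case (elim e)
    show ?case
    proof
      fix z assume z: "z \<in> \<Omega>"
      have "(\<Sum>k<2. fps_nth (pres F z) k * e ^ k) = pbar0 + pbar1 * e"
        using c[OF z] by (simp add: coeff_def numeral_2_eq_2)
      then have "\<bar>pres (W e) z - (pbar0 + pbar1 * e)\<bar> \<le> C * e\<^sup>2"
        using elim z by metis
      also have "\<dots> \<le> max C 1 * e\<^sup>2"
        by (intro mult_right_mono) auto
      finally show "\<bar>pres (W e) z - (pbar0 + pbar1 * e)\<bar> \<le> max C 1 * e\<^sup>2" .
    qed
  qed
  then show thesis by (intro that[of "max C 1"]) auto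
qed

text \<open>The pressure is uniformly close to the spatially constant \<open>pbar0 + pbar1 * e\<close>, hence so is its
  minimum.\<close>
lemma p_min_leading:
  assumes "expansion (\<lambda>e. p_min \<Omega> (W e)) Q"
  shows "Q $ 0 = pbar0"
proof -
  obtain C where
    "\<forall>\<^sub>F e in at_right 0. \<forall>z\<in>\<Omega>. \<bar>pres (W e) z - (pbar0 + pbar1 * e)\<bar> \<le> C * e\<^sup>2"
    using old_pressure_expansion by blast
  then have "\<forall>\<^sub>F e in at_right 0. norm (p_min \<Omega> (W e) - (pbar0 + pbar1 * e)) \<le> C * e\<^sup>2"
  proof eventually_elim
    case (elim e)
    then show ?case
      unfolding p_min_def real_norm_def by (intro INF_close(1) dom) auto
  qed
  moreover have "((\<lambda>e. C * e\<^sup>2) \<longlongrightarrow> 0) (at_right (0::real))"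
    by (auto intro!: tendsto_eq_intros)
  ultimately have 1: "((\<lambda>e. p_min \<Omega> (W e) - (pbar0 + pbar1 * e)) \<longlongrightarrow> 0) (at_right 0)"
    by (rule Lim_null_comparison)
  have 2: "((\<lambda>e. pbar0 + pbar1 * e) \<longlongrightarrow> pbar0) (at_right 0)"
    by (auto intro!: tendsto_eq_intros)
  have "((\<lambda>e. p_min \<Omega> (W e)) \<longlongrightarrow> pbar0) (at_right 0)"
    using tendsto_add[OF 1 2] by simp
  from tendsto_unique[OF _ expansion_tendsto[OF assms] this] show ?thesis
    by simp
qed

lemma old_density_lower:
  obtains c where "c > 0" "\<And>z. z \<in> \<Omega> \<Longrightarrow> c \<le> coeff 0 (dens F) z"
  using old by (auto simp: old_time_data_def)

lemma old_density_limit: "uniform_limit \<Omega> (\<lambda>e. dens (W e)) (coeff 0 (dens F)) (at_right 0)"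
  using old by (intro uniform_expansion_limit) (simp add: old_time_data_def)

lemma old_density_bdd_above: "bdd_above (coeff 0 (dens F) ` \<Omega>)"
proof -
  have "regular_field \<Omega> (coeff 0 (dens F))"
    using old by (simp add: old_time_data_def)
  then obtain M where "\<And>z. z \<in> \<Omega> \<Longrightarrow> \<bar>coeff 0 (dens F) z\<bar> \<le> M"
    using Ck_upto_bounded[OF regular_field_Ck dom(2)] by blast
  then show ?thesis
    by (intro bdd_aboveI2[where M = M]) (auto dest: abs_le_D1)
qed

lemma rho_max_leading:
  assumes "expansion (\<lambda>e. rho_max \<Omega> (W e)) R"
  shows "R $ 0 = (SUP z\<in>\<Omega>. coeff 0 (dens F) z)" "0 < R $ 0"
proof -
  let ?m = "SUP z\<in>\<Omega>. coeff 0 (dens F) z"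
  have "((\<lambda>e. rho_max \<Omega> (W e)) \<longlongrightarrow> ?m) (at_right 0)"
  proof (rule tendstoI)
    fix d :: real assume "d > 0"
    then have "\<forall>\<^sub>F e in at_right 0. \<forall>z\<in>\<Omega>. dist (dens (W e) z) (coeff 0 (dens F) z) < d / 2"
      using uniform_limitD[OF old_density_limit, of "d / 2"] by simp
    then show "\<forall>\<^sub>F e in at_right 0. dist (rho_max \<Omega> (W e)) ?m < d"
    proof eventually_elim
      case (elim e)
      then have "\<bar>rho_max \<Omega> (W e) - ?m\<bar> \<le> d / 2"
        unfolding rho_max_def
        by (intro SUP_close dom old_density_bdd_above) (auto simp: dist_real_def intro: less_imp_le)
      then show ?case
        using \<open>d > 0\<close> by (simp add: dist_real_def)
    qed
  qed
  from tendsto_unique[OF _ expansion_tendsto[OF assms] this] show eq: "R $ 0 = ?m"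
    by simp
  obtain c where c: "c > 0" "\<And>z. z \<in> \<Omega> \<Longrightarrow> c \<le> coeff 0 (dens F) z"
    using old_density_lower by blast
  obtain w where "w \<in> \<Omega>" using dom(3) by blast
  then have "c \<le> ?m"
    using c(2) by (intro cSUP_upper2[OF old_density_bdd_above])
  with c(1) eq show "0 < R $ 0" by simp
qed

text \<open>Both the pressure and its minimum deviate from \<open>pbar0 + pbar1 * e\<close> by at most \<open>C * e\<^sup>2\<close>, and the
  density eventually exceeds half the lower bound of its leading coefficient.\<close>
lemma sound_speed_bounded:
  assumes "\<gamma> > 0"
  obtains M where "\<forall>\<^sub>F e in at_right 0. \<forall>z\<in>\<Omega>.
    0 \<le> c_tilde \<Omega> \<gamma> e (W e) z \<and> c_tilde \<Omega> \<gamma> e (W e) z \<le> M"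
proof -
  obtain C where C: "C > 0"
    "\<forall>\<^sub>F e in at_right 0. \<forall>z\<in>\<Omega>. \<bar>pres (W e) z - (pbar0 + pbar1 * e)\<bar> \<le> C * e\<^sup>2"
    using old_pressure_expansion by blast
  obtain c where c: "c > 0" "\<And>z. z \<in> \<Omega> \<Longrightarrow> c \<le> coeff 0 (dens F) z"
    using old_density_lower by blast
  have "\<forall>\<^sub>F e in at_right 0. \<forall>z\<in>\<Omega>. dist (dens (W e) z) (coeff 0 (dens F) z) < c / 2"
    using uniform_limitD[OF old_density_limit, of "c / 2"] c(1) by simp
  moreover have "\<forall>\<^sub>F e in at_right 0. regular_field \<Omega> (dens (W e))"
    using old by (simp add: old_time_data_def eventually_conj_iff)
  moreover have "\<forall>\<^sub>F e in at_right 0. 0 < (e :: real)"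
    by (rule eventually_at_right_less)
  ultimately have "\<forall>\<^sub>F e in at_right 0. \<forall>z\<in>\<Omega>. 0 \<le> c_tilde \<Omega> \<gamma> e (W e) z \<and>
      c_tilde \<Omega> \<gamma> e (W e) z \<le> sqrt (\<gamma> * ((2 * C) / (c / 2)))"
    using C(2)
  proof eventually_elim
    case (elim e)
    obtain M where M: "\<And>z. z \<in> \<Omega> \<Longrightarrow> \<bar>dens (W e) z\<bar> \<le> M"
      using Ck_upto_bounded[OF regular_field_Ck[OF elim(2)] dom(2)] by blast
    then have bdd: "bdd_above (dens (W e) ` \<Omega>)"
      by (intro bdd_aboveI2[where M = M]) (auto dest: abs_le_D1)
    note P = INF_close[of \<Omega> "pres (W e)" "pbar0 + pbar1 * e" "C * e\<^sup>2", folded p_min_def]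
    show ?case
    proof
      fix z assume z: "z \<in> \<Omega>"
      have "c / 2 \<le> dens (W e) z"
        using bspec[OF elim(1) z] c(2)[OF z] unfolding dist_real_def by linarith
      moreover have "dens (W e) z \<le> rho_max \<Omega> (W e)"
        unfolding rho_max_def using z bdd by (rule cSUP_upper)
      moreover have "p_min \<Omega> (W e) \<le> pres (W e) z" "\<bar>p_min \<Omega> (W e) - (pbar0 + pbar1 * e)\<bar> \<le> C * e\<^sup>2"
        using P elim(4) dom(3) z by blast+
      moreover from this(2) have "pres (W e) z - p_min \<Omega> (W e) \<le> (2 * C) * e\<^sup>2"
        using elim(4) z by (fastforce simp: abs_le_iff)
      ultimately show "0 \<le> c_tilde \<Omega> \<gamma> e (W e) z \<and>
          c_tilde \<Omega> \<gamma> e (W e) z \<le> sqrt (\<gamma> * ((2 * C) / (c / 2)))"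
        using c_tilde_bound[of e \<gamma> "c / 2" z \<Omega> "W e" "2 * C"] assms elim(3) c(1) z by simp
    qed
  qed
  then show thesis by (rule that)
qed

lemma time_step_nondegenerate:
  assumes "\<gamma> > 0" "K > 0" "\<Delta>x > 0" "\<Delta>y > 0"
    and dt: "\<forall>\<^sub>F e in at_right 0. ereal (dt e) = cfl_time_step \<Omega> \<gamma> K \<Delta>x \<Delta>y e (W e)"
    and D: "expansion dt D"
  shows "0 < D $ 0"
proof -
  obtain Mc where Mc: "\<forall>\<^sub>F e in at_right 0. \<forall>z\<in>\<Omega>.
      0 \<le> c_tilde \<Omega> \<gamma> e (W e) z \<and> c_tilde \<Omega> \<gamma> e (W e) z \<le> Mc"
    using sound_speed_bounded[OF assms(1)] by blast
  obtain Mu where Mu: "\<forall>\<^sub>F e in at_right 0. \<forall>z\<in>\<Omega>. \<bar>velx (W e) z\<bar> \<le> Mu"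
    using old uniform_expansion_bounded[of \<Omega> "\<lambda>e. velx (W e)" "velx F"] dom(2)
    by (auto simp: old_time_data_def)
  obtain Mv where Mv: "\<forall>\<^sub>F e in at_right 0. \<forall>z\<in>\<Omega>. \<bar>vely (W e) z\<bar> \<le> Mv"
    using old uniform_expansion_bounded[of \<Omega> "\<lambda>e. vely (W e)" "vely F"] dom(2)
    by (auto simp: old_time_data_def)
  \<comment> \<open>The summand 1 makes the bound positive, so that it may appear in a denominator.\<close>
  define M where "M = \<bar>Mu\<bar> + \<bar>Mv\<bar> + \<bar>Mc\<bar> + 1"
  have M: "M > 0" by (simp add: M_def)
  let ?b = "K * min (\<Delta>x / M) (\<Delta>y / M)"
  from Mc Mu Mv dt have "\<forall>\<^sub>F e in at_right 0. ?b \<le> dt e"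
  proof eventually_elim
    case (elim e)
    have "ereal ?b \<le> ereal (dt e)"
      unfolding elim(4)
      by (rule cfl_time_step_lower[OF dom(3) assms(2-4) M])
        (use elim(1-3) in \<open>fastforce simp: M_def\<close>)+
    then show ?case by simp
  qed
  then have "?b \<le> D $ 0"
    by (intro tendsto_lowerbound[OF expansion_tendsto[OF D]]) auto
  moreover have "?b > 0"
    using assms M by simp
  ultimately show ?thesis by simp
qed

end

section \<open>Existence of an expansion at the new time level\<close>

text \<open>Solvability is available for right-hand sides that are continuous on the closure, whereas the
  right-hand sides that occur here are determined on the open set alone and merely have a
  continuous extension.\<close>
lemma dirichlet_problem:
  assumes "open \<Omega>" "dirichlet_solvable \<Omega>"
    and "\<And>k. Ck_upto k \<Omega> \<Omega> f" "extends_to \<Omega> (closure \<Omega>) f" "continuous_on (frontier \<Omega>) g"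
  obtains \<phi> where "smooth_in \<Omega> \<phi>" "continuous_on (closure \<Omega>) \<phi>"
    "\<And>z. z \<in> \<Omega> \<Longrightarrow> px (px \<phi>) z + py (py \<phi>) z = f z" "\<And>z. z \<in> frontier \<Omega> \<Longrightarrow> \<phi> z = g z"
proof -
  obtain f' where f': "continuous_on (closure \<Omega>) f'" "\<And>z. z \<in> \<Omega> \<Longrightarrow> f' z = f z"
    using extends_toE[OF assms(4)] by blast
  have "smooth_in \<Omega> f'"
    unfolding smooth_in_iff using Ck_upto_cong[OF assms(1) f'(2)[symmetric] assms(3)] by blast
  then obtain \<phi> where "smooth_in \<Omega> \<phi>" "continuous_on (closure \<Omega>) \<phi>"
    "\<forall>z\<in>\<Omega>. px (px \<phi>) z + py (py \<phi>) z = f' z" "\<forall>z\<in>frontier \<Omega>. \<phi> z = g z"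
    using assms(2,5) f'(1) unfolding dirichlet_solvable_def by blast
  then show thesis
    using f'(2) by (intro that[of \<phi>]) simp_all
qed

text \<open>The orders 0 and 1 are taken to be the constants prescribed on the boundary. Each later order
  solves a Dirichlet problem whose right-hand side depends on the orders that are lower by at least
  2, so the sequence exists by recursion with choice. The series \<open>P\<close> solves
  \<open>\<Delta>P = \<epsilon>\<^sup>2 * m * (P - G)\<close>.\<close>
lemma poisson_hierarchy:
  fixes m :: "real fps" and G :: "point \<Rightarrow> real fps"
  assumes "open \<Omega>" "dirichlet_solvable \<Omega>"
    and G: "\<And>k. field_Ck k \<Omega> \<Omega> G" "field_Ck 0 \<Omega> (closure \<Omega>) G"
    and B: "boundary_data \<Omega> pbar0 pbar1 B"
  obtains P where
    "\<And>k. smooth_in \<Omega> (coeff k P)" "\<And>k. continuous_on (closure \<Omega>) (coeff k P)"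
    "\<And>z. z \<in> frontier \<Omega> \<Longrightarrow> P z = B z"
    "\<And>z. z \<in> \<Omega> \<Longrightarrow> coeff 0 P z = pbar0" "\<And>z. z \<in> \<Omega> \<Longrightarrow> coeff 1 P z = pbar1"
    "\<And>k z. z \<in> \<Omega> \<Longrightarrow> px (px (coeff (k + 2) P)) z + py (py (coeff (k + 2) P)) z
      = (m * (P z - G z)) $ k"
proof -
  \<comment> \<open>The \<open>n\<close>-th coefficient of \<open>m * (f - G)\<close>, the right-hand side at order \<open>n + 2\<close>.\<close>
  define rhs where "rhs = (\<lambda>(f :: nat \<Rightarrow> point \<Rightarrow> real) n z.
    \<Sum>i=0..n. m $ i * (f (n - i) z + - coeff (n - i) G z))"
  define solves_order where "solves_order = (\<lambda>f k \<phi>. smooth_in \<Omega> \<phi> \<and> continuous_on (closure \<Omega>) \<phi> \<and>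
    (\<forall>z\<in>frontier \<Omega>. \<phi> z = coeff k B z) \<and>
    (case k of 0 \<Rightarrow> \<forall>z\<in>\<Omega>. \<phi> z = pbar0 | Suc 0 \<Rightarrow> \<forall>z\<in>\<Omega>. \<phi> z = pbar1
      | Suc (Suc n) \<Rightarrow> \<forall>z\<in>\<Omega>. px (px \<phi>) z + py (py \<phi>) z = rhs f n z))"
  have const: "smooth_in \<Omega> (\<lambda>z. c)" for c
    by (simp add: smooth_in_iff Ck_upto_const)
  have "\<exists>f. \<forall>k. solves_order f k (f k)"
  proof (rule dependent_wellorder_choice)
    fix \<phi> k and f g :: "nat \<Rightarrow> point \<Rightarrow> real"
    assume "\<And>j. j < k \<Longrightarrow> f j = g j"
    then have "rhs f n = rhs g n" if "k = Suc (Suc n)" for n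
      using that by (auto simp: rhs_def fun_eq_iff intro!: sum.cong)
    then show "solves_order f k \<phi> = solves_order g k \<phi>"
      unfolding solves_order_def by (auto split: nat.split)
  next
    fix k and f :: "nat \<Rightarrow> point \<Rightarrow> real"
    assume IH: "\<And>j. j < k \<Longrightarrow> solves_order f j (f j)"
    show "\<exists>\<phi>. solves_order f k \<phi>"
    proof (cases "k < 2")
      case True
      then have "solves_order f k (\<lambda>z. if k = 0 then pbar0 else pbar1)"
        using B const unfolding solves_order_def boundary_data_def by (auto simp: less_2_cases_iff)
      then show ?thesis by blast
    next
      case False
      then obtain n where k: "k = Suc (Suc n)"
        using that[of "k - 2"] by simp
      have f: "smooth_in \<Omega> (f j)" "continuous_on (closure \<Omega>) (f j)" if "j \<le> n" for j
        using IH[of j] that k by (simp_all add: solves_order_def)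
      then have fC: "Ck_upto i \<Omega> \<Omega> (f j)" "Ck_upto 0 \<Omega> (closure \<Omega>) (f j)" if "j \<le> n" for i j
        using that by (auto simp: smooth_in_iff extends_to_def)
      have rhs: "Ck_upto i \<Omega> T (rhs f n)"
        if "\<And>j. j \<le> n \<Longrightarrow> Ck_upto i \<Omega> T (f j)" "field_Ck i \<Omega> T G" for i T
        unfolding rhs_def using that
        by (intro Ck_upto_sum Ck_upto_mult Ck_upto_const Ck_upto_add Ck_upto_uminus assms(1) field_CkD)
          simp_all
      have "continuous_on (frontier \<Omega>) (coeff k B)"
        using B by (simp add: boundary_data_def)
      from dirichlet_problem[OF assms(1,2) rhs[OF fC(1) G(1)]
          Ck_upto_extends[OF rhs[OF fC(2) G(2)]] this]
      obtain \<phi> where "smooth_in \<Omega> \<phi>" "continuous_on (closure \<Omega>) \<phi>"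
        "\<And>z. z \<in> \<Omega> \<Longrightarrow> px (px \<phi>) z + py (py \<phi>) z = rhs f n z"
        "\<And>z. z \<in> frontier \<Omega> \<Longrightarrow> \<phi> z = coeff k B z"
        by blast
      then have "solves_order f k \<phi>"
        by (simp add: solves_order_def k)
      then show ?thesis by blast
    qed
  qed
  then obtain f where f: "\<And>k. solves_order f k (f k)" by blast
  define P where "P = (\<lambda>z. Abs_fps (\<lambda>k. f k z))"
  have coeff: "coeff k P = f k" for k
    by (simp add: coeff_def P_def)
  show thesis
  proof (rule that[of P])
    show "P z = B z" if "z \<in> frontier \<Omega>" for z
      using f that by (intro fps_ext) (simp add: solves_order_def P_def coeff_def)
    show "coeff 0 P z = pbar0" "coeff 1 P z = pbar1" if "z \<in> \<Omega>" for z
      using f[of 0] f[of 1] that by (simp_all add: solves_order_def coeff)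
    show "px (px (coeff (k + 2) P)) z + py (py (coeff (k + 2) P)) z = (m * (P z - G z)) $ k"
      if "z \<in> \<Omega>" for k z
      using f[of "k + 2"] that
      by (simp add: solves_order_def coeff rhs_def fps_mult_nth P_def coeff_def)
  qed (use f in \<open>simp_all add: solves_order_def coeff\<close>)
qed

lemma fps_shift_2_cancel:
  fixes f :: "real fps"
  assumes "f $ 0 = 0" "f $ 1 = 0"
  shows "fps_X\<^sup>2 * fps_shift 2 f = f"
proof (rule fps_ext)
  fix n :: nat
  have "n = 0 \<or> n = 1 \<or> (\<exists>k. n = k + 2)"
    by presburger
  then consider "n = 0" | "n = 1" | k where "n = k + 2"
    by blast
  then show "(fps_X\<^sup>2 * fps_shift 2 f) $ n = f $ n"
    using assms by cases (simp_all add: fps_X_power_mult_nth)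
qed

text \<open>This is why the factors \<open>1 / \<epsilon>\<^sup>2\<close> in front of the pressure gradients are harmless.\<close>
lemma fpartial_lower_zero:
  assumes "open \<Omega>" "z \<in> \<Omega>"
    and "\<And>w. w \<in> \<Omega> \<Longrightarrow> coeff 0 P w = c0" "\<And>w. w \<in> \<Omega> \<Longrightarrow> coeff 1 P w = c1"
  shows "fpartial b P z $ 0 = 0" "fpartial b P z $ 1 = 0"
  using partial_cong[OF assms(1,2,3)] partial_cong[OF assms(1,2,4)]
  by (simp_all add: fpartial_def)

text \<open>The part of the new velocity component that is explicit in the old data; the shift by 2 is the
  division of the old pressure gradient by \<open>\<epsilon>\<^sup>2\<close>.\<close>
definition predicted_velocity ::
    "real fps \<Rightarrow> real fps \<Rightarrow> real fps state \<Rightarrow> point \<Rightarrow> (point \<Rightarrow> real fps) \<Rightarrow> point \<Rightarrow> real fps" where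
  "predicted_velocity R D F b w z =
     w z - D * (velx F z * fpx w z + vely F z * fpy w z
       + (inverse (dens F z) - inverse R) * fps_shift 2 (fpartial b (pres F) z))"

text \<open>The right-hand side \<open>G\<close> of the elliptic equation for the new pressure: the new pressure that
  would result if the implicit pressure gradient were dropped from the velocity update.\<close>
definition predicted_pressure ::
    "real \<Rightarrow> real fps \<Rightarrow> real fps \<Rightarrow> real fps \<Rightarrow> real fps state \<Rightarrow> point \<Rightarrow> real fps" where
  "predicted_pressure \<gamma> R Q D F z =
     pres F z - D * (velx F z * fpx (pres F) z + vely F z * fpy (pres F) z
       + fps_const \<gamma> * (pres F z - Q) * (fpx (velx F) z + fpy (vely F) z)
       + fps_const \<gamma> * Q * (fpx (predicted_velocity R D F (1, 0) (velx F)) z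
           + fpy (predicted_velocity R D F (0, 1) (vely F)) z))"

lemma Basis_point: "(1, 0) \<in> (Basis :: point set)" "(0, 1) \<in> (Basis :: point set)"
  by (simp_all add: Basis_prod_def)

lemma field_Ck_fpx: "field_Ck (Suc k) S T F \<Longrightarrow> field_Ck k S T (fpx F)"
  and field_Ck_fpy: "field_Ck (Suc k) S T F \<Longrightarrow> field_Ck k S T (fpy F)"
  by (simp_all add: fpx_eq fpy_eq field_Ck_fpartial Basis_point)

lemma field_Ck_predicted_velocity:
  assumes "open S" "c > 0" "\<And>z. z \<in> S \<Longrightarrow> c \<le> coeff 0 (dens F) z" "b \<in> Basis"
    and "field_Ck (Suc k) S T (dens F)" "field_Ck (Suc k) S T (velx F)"
      "field_Ck (Suc k) S T (vely F)" "field_Ck (Suc k) S T (pres F)" "field_Ck (Suc k) S T w"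
  shows "field_Ck k S T (predicted_velocity R D F b w)"
  unfolding predicted_velocity_def[abs_def] using assms
  by (intro field_Ck_diff field_Ck_mult field_Ck_add field_Ck_const field_Ck_shift field_Ck_fpx
      field_Ck_fpy field_Ck_fpartial field_Ck_inverse[where c = c])
    (auto intro: field_Ck_mono[of k "Suc k"])

text \<open>Two derivatives are lost, one in the prediction of the velocity and one in its divergence.\<close>
lemma field_Ck_predicted_pressure:
  assumes "open S" "c > 0" "\<And>z. z \<in> S \<Longrightarrow> c \<le> coeff 0 (dens F) z"
    and "field_Ck (Suc (Suc k)) S T (dens F)" "field_Ck (Suc (Suc k)) S T (velx F)"
      "field_Ck (Suc (Suc k)) S T (vely F)" "field_Ck (Suc (Suc k)) S T (pres F)"
  shows "field_Ck k S T (predicted_pressure \<gamma> R Q D F)"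
  unfolding predicted_pressure_def[abs_def] using assms
  by (intro field_Ck_diff field_Ck_mult field_Ck_add field_Ck_const field_Ck_fpx field_Ck_fpy
      field_Ck_predicted_velocity[where c = c] Basis_point)
    (auto intro: field_Ck_mono[of k "Suc (Suc k)"] field_Ck_mono[of "Suc k" "Suc (Suc k)"])

lemma momentum_closes:
  fixes D :: "'a::comm_ring_1"
  assumes "D * iD = 1"
  shows "X * ((u - D * (a + c * q) - D * iR * q' - u) * iD + a) + c * (X * q) + iR * (X * q') = 0"
    (is "?L = 0")
proof -
  have "?L = X * (a + c * q + iR * q') * (1 - D * iD)"
    by (simp add: algebra_simps)
  with assms show ?thesis by simp
qed

text \<open>Back substitution into the pressure equation. Here \<open>N\<close> collects the explicit terms, \<open>U\<close> is the
  divergence of the predicted velocity, and \<open>m\<close> is the reciprocal of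
  \<open>\<gamma> p\<^sub>m\<^sub>i\<^sub>n \<Delta>t\<^sup>2 / \<rho>\<^sub>m\<^sub>a\<^sub>x\<close>, the coefficient of the Laplacian in the elliptic equation.\<close>
lemma pressure_closes:
  fixes D :: "'a::comm_ring_1"
  assumes "D * iD = 1" "g * Q * D * D * iR * m = 1"
  shows "(p' - p) * iD
    + (N + g * Q * (U - D * iR * (m * (p' - (p - D * (N + g * Q * U)))))) = 0"
    (is "?L = 0")
proof -
  have "g * Q * D * iR * m = g * Q * D * iR * m * (D * iD)"
    by (simp add: assms(1))
  also have "\<dots> = (g * Q * D * D * iR * m) * iD"
    by (simp only: ac_simps)
  finally have k: "g * Q * D * iR * m = iD"
    by (simp add: assms(2))
  have "?L = (p' - p) * iD + (N + g * Q * U)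
      - (g * Q * D * iR * m) * (p' - p + D * (N + g * Q * U))"
    by (simp add: algebra_simps)
  also have "\<dots> = (N + g * Q * U) * (1 - D * iD)"
    unfolding k by (simp add: algebra_simps)
  finally show ?thesis
    by (simp add: assms(1))
qed

text \<open>The new pressure comes from the hierarchy of Poisson problems; the velocity is obtained from it by
  the momentum equation and the density by an explicit update. The pressure equation then holds
  because the divergence of this velocity is the predicted one minus a multiple of the Laplacian
  of the pressure, which the hierarchy expresses through the pressure itself.\<close>
lemma new_time_expansion_exists:
  assumes "open \<Omega>" "dirichlet_solvable \<Omega>"
    and old: "old_time_data \<Omega> pbar0 pbar1 W F" and B: "boundary_data \<Omega> pbar0 pbar1 B"
    and nz: "\<gamma> \<noteq> 0" "R $ 0 \<noteq> 0" "Q $ 0 \<noteq> 0" "D $ 0 \<noteq> 0"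
  shows "\<exists>F'. new_time_expansion \<Omega> B (semi_implicit_step \<Omega> \<gamma> R Q D F) F'"
proof -
  obtain c where c: "c > 0" "\<And>z. z \<in> \<Omega> \<Longrightarrow> c \<le> coeff 0 (dens F) z"
    using old by (auto simp: old_time_data_def)
  have r0: "dens F z $ 0 \<noteq> 0" if "z \<in> \<Omega>" for z
    using c(1) c(2)[OF that] by (simp add: coeff_def)
  have p01: "coeff 0 (pres F) z = pbar0" "coeff 1 (pres F) z = pbar1" if "z \<in> \<Omega>" for z
    using old that by (auto simp: old_time_data_def compatible_def)
  have "\<forall>k. regular_field \<Omega> (coeff k (dens F)) \<and> regular_field \<Omega> (coeff k (velx F)) \<and>
      regular_field \<Omega> (coeff k (vely F)) \<and> regular_field \<Omega> (coeff k (pres F))"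
    using old by (simp add: old_time_data_def)
  then have
    smooth: "field_Ck k \<Omega> \<Omega> (dens F)" "field_Ck k \<Omega> \<Omega> (velx F)"
      "field_Ck k \<Omega> \<Omega> (vely F)" "field_Ck k \<Omega> \<Omega> (pres F)" and
    upto: "field_Ck 2 \<Omega> (closure \<Omega>) (dens F)" "field_Ck 2 \<Omega> (closure \<Omega>) (velx F)"
      "field_Ck 2 \<Omega> (closure \<Omega>) (vely F)" "field_Ck 2 \<Omega> (closure \<Omega>) (pres F)" for k
    by (simp_all add: field_Ck_def regular_field_def smooth_in_iff Ck_upto_closure)
  let ?uh = "predicted_velocity R D F (1, 0) (velx F)"
  let ?vh = "predicted_velocity R D F (0, 1) (vely F)"
  let ?G = "predicted_pressure \<gamma> R Q D F"
  have "field_Ck k \<Omega> \<Omega> ?uh" for k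
    by (rule field_Ck_predicted_velocity[OF assms(1) c Basis_point(1) smooth smooth(2)])
  moreover have "field_Ck k \<Omega> \<Omega> ?vh" for k
    by (rule field_Ck_predicted_velocity[OF assms(1) c Basis_point(2) smooth smooth(3)])
  ultimately have hat: "field_Ck k \<Omega> \<Omega> ?uh" "field_Ck k \<Omega> \<Omega> ?vh" for k
    by blast+
  have G: "field_Ck k \<Omega> \<Omega> ?G" for k
    by (rule field_Ck_predicted_pressure[OF assms(1) c smooth])
  have G_closure: "field_Ck 0 \<Omega> (closure \<Omega>) ?G"
    by (rule field_Ck_predicted_pressure[OF assms(1) c upto[unfolded numeral_2_eq_2]])
  \<comment> \<open>The reciprocal of \<open>A = \<gamma> p\<^sub>m\<^sub>i\<^sub>n \<Delta>t\<^sup>2 / \<rho>\<^sub>m\<^sub>a\<^sub>x\<close>.\<close>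
  define m where "m = inverse (fps_const \<gamma> * Q * D * D * inverse R)"
  have m: "fps_const \<gamma> * Q * D * D * inverse R * m = 1"
    unfolding m_def by (rule inverse_mult_eq_1') (simp add: nz)
  obtain P where P: "\<And>k. smooth_in \<Omega> (coeff k P)" "\<And>k. continuous_on (closure \<Omega>) (coeff k P)"
    "\<And>z. z \<in> frontier \<Omega> \<Longrightarrow> P z = B z"
    "\<And>z. z \<in> \<Omega> \<Longrightarrow> coeff 0 P z = pbar0" "\<And>z. z \<in> \<Omega> \<Longrightarrow> coeff 1 P z = pbar1"
    "\<And>k z. z \<in> \<Omega> \<Longrightarrow> px (px (coeff (k + 2) P)) z + py (py (coeff (k + 2) P)) z
      = (m * (P z - ?G z)) $ k"
    using poisson_hierarchy[OF assms(1,2) G G_closure B] by blast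
  define q where "q = (\<lambda>b z. fps_shift 2 (fpartial b P z))"
  have PC: "field_Ck k \<Omega> \<Omega> P" for k
    using P(1) by (simp add: field_Ck_def smooth_in_iff)
  have qC: "field_Ck k \<Omega> \<Omega> (q b)" if "b \<in> Basis" for k b
    unfolding q_def by (intro field_Ck_shift field_Ck_fpartial PC that)
  define F' where "F' = \<lparr>
    dens = (\<lambda>z. dens F z - D * (fpx (\<lambda>w. dens F w * velx F w) z + fpy (\<lambda>w. dens F w * vely F w) z)),
    velx = (\<lambda>z. ?uh z - D * inverse R * q (1, 0) z),
    vely = (\<lambda>z. ?vh z - D * inverse R * q (0, 1) z),
    pres = P\<rparr>"
  have "field_Ck k \<Omega> \<Omega> (dens F')" "field_Ck k \<Omega> \<Omega> (velx F')" "field_Ck k \<Omega> \<Omega> (vely F')" for k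
    unfolding F'_def state.simps
    by (intro field_Ck_diff field_Ck_mult field_Ck_add field_Ck_const field_Ck_fpx field_Ck_fpy
        smooth hat qC Basis_point assms(1))+
  then have smooth': "smooth_in \<Omega> (coeff k (dens F'))" "smooth_in \<Omega> (coeff k (velx F'))"
    "smooth_in \<Omega> (coeff k (vely F'))" for k
    by (simp_all add: field_Ck_def smooth_in_iff)
  have div: "fpx (velx F') z + fpy (vely F') z
      = fpx ?uh z + fpy ?vh z - D * inverse R * (m * (P z - ?G z))" if z: "z \<in> \<Omega>" for z
  proof -
    have diff: "coeff n H differentiable at z" if "field_Ck (Suc 0) \<Omega> \<Omega> H" for n H
      using Ck_upto_differentiable[OF field_CkD[OF that] assms(1) z] .
    have upd: "fpartial b (\<lambda>w. H w - D * inverse R * q b w) z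
        = fpartial b H z - D * inverse R * fpartial b (q b) z"
      if "b \<in> Basis" "field_Ck (Suc 0) \<Omega> \<Omega> H" for b H
      using diff[OF that(2)] diff[OF qC[OF that(1)]]
        diff[OF field_Ck_mult[OF assms(1) field_Ck_const qC[OF that(1)]]]
      by (simp add: fpartial_diff fpartial_cmult)
    \<comment> \<open>The Laplacian of the new pressure, divided by \<open>\<epsilon>\<^sup>2\<close>.\<close>
    have lap: "fpartial (1, 0) (q (1, 0)) z + fpartial (0, 1) (q (0, 1)) z = m * (P z - ?G z)"
      using P(6)[OF z] by (intro fps_ext) (simp add: fpartial_def q_def coeff_def)
    show ?thesis
      unfolding F'_def state.simps fpx_eq fpy_eq upd[OF Basis_point(1) hat(1)]
        upd[OF Basis_point(2) hat(2)] lap[symmetric]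
      by (simp add: algebra_simps)
  qed
  have "semi_implicit_step \<Omega> \<gamma> R Q D F F'"
  proof (subst semi_implicit_step_iff, goal_cases)
    case 4
    show ?case
    proof (intro ballI conjI)
      fix z assume z: "z \<in> \<Omega>"
      have iD: "D * inverse D = 1"
        using nz(4) by (rule inverse_mult_eq_1')
      have old_grad: "fps_X\<^sup>2 * fps_shift 2 (fpartial b (pres F) z) = fpartial b (pres F) z" for b
        by (intro fps_shift_2_cancel fpartial_lower_zero[OF assms(1) z p01])
      have new_grad: "fps_X\<^sup>2 * q b z = fpartial b P z" for b
        unfolding q_def by (intro fps_shift_2_cancel fpartial_lower_zero[OF assms(1) z P(4,5)])
      have mom: "fps_X\<^sup>2 * ((w - D * (a + (inverse (dens F z) - inverse R)
            * fps_shift 2 (fpartial b (pres F) z)) - D * inverse R * q b z - w) * inverse D + a)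
          + (inverse (dens F z) - inverse R) * fpartial b (pres F) z
          + inverse R * fpartial b P z = 0" for w a b
        using momentum_closes[OF iD, of "fps_X\<^sup>2" w a "inverse (dens F z) - inverse R"
            "fps_shift 2 (fpartial b (pres F) z)" "inverse R" "q b z"]
        unfolding old_grad new_grad .
      show "dens F' z = dens F z
          - D * (fpx (\<lambda>w. dens F w * velx F w) z + fpy (\<lambda>w. dens F w * vely F w) z)"
        by (simp add: F'_def)
      show "fps_X\<^sup>2 * ((velx F' z - velx F z) * inverse D
            + (velx F z * fpx (velx F) z + vely F z * fpy (velx F) z))
          + (inverse (dens F z) - inverse R) * fpx (pres F) z + inverse R * fpx (pres F') z = 0"
        unfolding F'_def state.simps predicted_velocity_def
        unfolding fpx_eq by (rule mom)
      show "fps_X\<^sup>2 * ((vely F' z - vely F z) * inverse D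
            + (velx F z * fpx (vely F) z + vely F z * fpy (vely F) z))
          + (inverse (dens F z) - inverse R) * fpy (pres F) z + inverse R * fpy (pres F') z = 0"
        unfolding F'_def state.simps predicted_velocity_def
        unfolding fpy_eq by (rule mom)
      show "(pres F' z - pres F z) * inverse D
          + (velx F z * fpx (pres F) z + vely F z * fpy (pres F) z
            + fps_const \<gamma> * (pres F z - Q) * (fpx (velx F) z + fpy (vely F) z)
            + fps_const \<gamma> * Q * (fpx (velx F') z + fpy (vely F') z)) = 0"
        unfolding div[OF z] predicted_pressure_def unfolding F'_def state.simps
        by (rule pressure_closes[OF iD m])
    qed
  qed (use nz r0 in simp_all)
  moreover have "pres F' = P"
    by (simp add: F'_def)
  ultimately have "new_time_expansion \<Omega> B (semi_implicit_step \<Omega> \<gamma> R Q D F) F'"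
    unfolding new_time_expansion_def using smooth' P(1-3) by blast
  then show ?thesis by blast
qed

section \<open>The limit of every expansion at the new time level\<close>

text \<open>The domain is connected, so a vanishing gradient makes the function constant on it and, by
  continuity, on the closure. A nonempty bounded open set has a boundary point, which fixes the
  value.\<close>
lemma constant_from_boundary:
  fixes \<phi> :: "point \<Rightarrow> real"
  assumes "open \<Omega>" "connected \<Omega>" "bounded \<Omega>" "z \<in> \<Omega>"
    and diff: "\<And>w. w \<in> \<Omega> \<Longrightarrow> \<phi> differentiable at w"
    and grad: "\<And>w. w \<in> \<Omega> \<Longrightarrow> px \<phi> w = 0" "\<And>w. w \<in> \<Omega> \<Longrightarrow> py \<phi> w = 0"
    and cont: "continuous_on (closure \<Omega>) \<phi>" and bnd: "\<And>w. w \<in> frontier \<Omega> \<Longrightarrow> \<phi> w = c"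
  shows "\<phi> z = c"
proof -
  have D: "(\<phi> has_derivative (\<lambda>h. 0)) (at w)" if w: "w \<in> \<Omega>" for w
  proof -
    let ?D = "frechet_derivative \<phi> (at w)"
    have d: "(\<phi> has_derivative ?D) (at w)"
      using diff[OF w] by (simp add: frechet_derivative_works)
    then have lin: "linear ?D"
      by (rule has_derivative_linear)
    have "?D h = 0" for h
    proof -
      have "?D h = ?D (fst h *\<^sub>R (1, 0) + snd h *\<^sub>R (0, 1))"
        by simp
      also have "\<dots> = fst h *\<^sub>R ?D (1, 0) + snd h *\<^sub>R ?D (0, 1)"
        by (simp only: linear_add[OF lin] linear_scale[OF lin])
      also have "\<dots> = 0"
        using grad[OF w] by simp
      finally show ?thesis .
    qed
    then have "?D = (\<lambda>h. 0)" by (rule ext)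
    with d show ?thesis by (simp only:)
  qed
  have const: "\<phi> w = \<phi> z" if "w \<in> \<Omega>" for w
    using has_derivative_zero_unique_connected[OF assms(1,2) D that assms(4)] .
  have "\<Omega> \<noteq> UNIV"
    using assms(3) by auto
  then obtain b where b: "b \<in> frontier \<Omega>"
    using assms(4) frontier_not_empty by blast
  then have "\<phi> b = \<phi> z"
    using continuous_constant_on_closure[OF cont const] by (simp add: frontier_def)
  with bnd[OF b] show ?thesis by simp
qed

text \<open>Here \<open>S\<close> and \<open>N\<close> are one component of the old and of the new pressure gradient. The factor
  \<open>\<epsilon>\<^sup>2\<close> keeps \<open>T\<close> out of the orders 0 and 1, so \<open>N\<close> vanishes there along with \<open>S\<close>.\<close>
lemma momentum_orders:
  fixes T a b S N :: "real fps"
  assumes "fps_X\<^sup>2 * T + a * S + b * N = 0" "S $ 0 = 0" "S $ 1 = 0" "b $ 0 \<noteq> 0"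
  shows "N $ 0 = 0" "N $ 1 = 0" "T $ 0 + a $ 0 * S $ 2 + b $ 0 * N $ 2 = 0"
proof -
  have E: "(fps_X\<^sup>2 * T + a * S + b * N) $ k = 0" for k
    unfolding assms(1) by simp
  show 0: "N $ 0 = 0"
    using E[of 0] assms(2,4) by (simp add: fps_X_power_mult_nth)
  show 1: "N $ 1 = 0"
    using E[of 1] assms(2-4) 0 by (simp add: fps_X_power_mult_nth fps_mult_nth)
  show "T $ 0 + a $ 0 * S $ 2 + b $ 0 * N $ 2 = 0"
    using E[of 2] assms(2,3) 0 1 by (simp add: fps_X_power_mult_nth fps_mult_nth numeral_2_eq_2)
qed

text \<open>Here \<open>P\<close> is the pressure increment, \<open>(a, b)\<close> the old pressure gradient, and \<open>d\<close>, \<open>d'\<close> are the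
  old and the new divergence. All terms but the last vanish at the orders 0 and 1.\<close>
lemma pressure_orders:
  fixes P :: "real fps"
  assumes "P * iD + (u * a + v * b + fps_const \<gamma> * q * d + fps_const \<gamma> * Q * d') = 0"
    and "P $ 0 = 0" "P $ 1 = 0" "a $ 0 = 0" "a $ 1 = 0" "b $ 0 = 0" "b $ 1 = 0"
      "d $ 0 = 0" "d $ 1 = 0" and "\<gamma> \<noteq> 0" "Q $ 0 \<noteq> 0"
  shows "d' $ 0 = 0" "d' $ 1 = 0"
proof -
  have E: "(P * iD + (u * a + v * b + fps_const \<gamma> * q * d + fps_const \<gamma> * Q * d')) $ k = 0" for k
    unfolding assms(1) by simp
  show 0: "d' $ 0 = 0"
    using E[of 0] assms(2-) by simp
  show "d' $ 1 = 0"
    using E[of 1] assms(2-) 0 by (simp add: fps_mult_nth)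
qed

text \<open>First the momentum equation at the orders 0 and 1 and the boundary condition determine the
  pressure, then the pressure equation determines the divergence, and finally the momentum
  equation at order 2 is the velocity update of the limiting discretization.\<close>
lemma new_time_expansion_limit:
  assumes dom: "open \<Omega>" "connected \<Omega>" "bounded \<Omega>"
    and old: "old_time_data \<Omega> pbar0 pbar1 W F" and B: "boundary_data \<Omega> pbar0 pbar1 B"
    and nz: "\<gamma> \<noteq> 0" "D $ 0 \<noteq> 0" "Q $ 0 \<noteq> 0" "R $ 0 \<noteq> 0"
    and R: "R $ 0 = (SUP z\<in>\<Omega>. coeff 0 (dens F) z)"
    and new: "new_time_expansion \<Omega> B (semi_implicit_step \<Omega> \<gamma> R Q D F) F'"
  shows "compatible \<Omega> pbar0 pbar1 F'"
    and "\<And>z. z \<in> \<Omega> \<Longrightarrow>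
      limit_discretization \<Omega> pbar0 pbar1 (D $ 0) (leading_coeffs F) (leading_coeffs F') z = 0"
proof -
  obtain c where c: "c > 0" "\<And>z. z \<in> \<Omega> \<Longrightarrow> c \<le> coeff 0 (dens F) z"
    using old by (auto simp: old_time_data_def)
  have r0: "dens F z $ 0 \<noteq> 0" if "z \<in> \<Omega>" for z
    using c(1) c(2)[OF that] by (simp add: coeff_def)
  have F: "coeff 0 (pres F) z = pbar0" "coeff 1 (pres F) z = pbar1"
    "(fpx (velx F) z + fpy (vely F) z) $ 0 = 0" "(fpx (velx F) z + fpy (vely F) z) $ 1 = 0"
    if "z \<in> \<Omega>" for z
    using old that by (simp_all add: old_time_data_def compatible_def fpx_def fpy_def)
  have old_grad: "fpx (pres F) z $ 0 = 0" "fpx (pres F) z $ 1 = 0"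
    "fpy (pres F) z $ 0 = 0" "fpy (pres F) z $ 1 = 0" if "z \<in> \<Omega>" for z
    unfolding fpx_eq fpy_eq using fpartial_lower_zero[OF dom(1) that F(1,2)] by blast+
  have "semi_implicit_step \<Omega> \<gamma> R Q D F F'"
    using new by (simp add: new_time_expansion_def)
  then have step: "\<forall>z\<in>\<Omega>.
    dens F' z = dens F z - D * (fpx (\<lambda>w. dens F w * velx F w) z + fpy (\<lambda>w. dens F w * vely F w) z) \<and>
    fps_X\<^sup>2 * ((velx F' z - velx F z) * inverse D
        + (velx F z * fpx (velx F) z + vely F z * fpy (velx F) z))
      + (inverse (dens F z) - inverse R) * fpx (pres F) z + inverse R * fpx (pres F') z = 0 \<and>
    fps_X\<^sup>2 * ((vely F' z - vely F z) * inverse D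
        + (velx F z * fpx (vely F) z + vely F z * fpy (vely F) z))
      + (inverse (dens F z) - inverse R) * fpy (pres F) z + inverse R * fpy (pres F') z = 0 \<and>
    (pres F' z - pres F z) * inverse D
      + (velx F z * fpx (pres F) z + vely F z * fpy (pres F) z
        + fps_const \<gamma> * (pres F z - Q) * (fpx (velx F) z + fpy (vely F) z)
        + fps_const \<gamma> * Q * (fpx (velx F') z + fpy (vely F') z)) = 0"
    by (subst (asm) semi_implicit_step_iff) (use nz r0 in simp_all)
  have iR: "inverse R $ 0 \<noteq> 0"
    using nz(4) by simp
  note momx = momentum_orders[OF step[rule_format, THEN conjunct2, THEN conjunct1] old_grad(1,2) iR]
    and momy = momentum_orders[OF step[rule_format, THEN conjunct2, THEN conjunct2, THEN conjunct1]
      old_grad(3,4) iR]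
  have diff: "coeff k (pres F') differentiable at z" if "z \<in> \<Omega>" for k z
  proof -
    have "Ck_upto (Suc 0) \<Omega> \<Omega> (coeff k (pres F'))"
      using new by (simp add: new_time_expansion_def smooth_in_iff del: Ck_upto.simps)
    then show ?thesis
      using Ck_upto_differentiable dom(1) that by blast
  qed
  have cont: "continuous_on (closure \<Omega>) (coeff k (pres F'))" for k
    using new by (simp add: new_time_expansion_def)
  have bnd: "coeff 0 (pres F') z = pbar0" "coeff 1 (pres F') z = pbar1" if "z \<in> frontier \<Omega>" for z
    using new B that by (simp_all add: new_time_expansion_def boundary_data_def coeff_def)
  have grad0: "px (coeff 0 (pres F')) z = 0" "py (coeff 0 (pres F')) z = 0"
    and grad1: "px (coeff 1 (pres F')) z = 0" "py (coeff 1 (pres F')) z = 0" if "z \<in> \<Omega>" for z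
    using momx(1,2)[OF that that that] momy(1,2)[OF that that that] by (simp_all add: fpx_def fpy_def)
  have p: "coeff 0 (pres F') z = pbar0" "coeff 1 (pres F') z = pbar1" if "z \<in> \<Omega>" for z
    using constant_from_boundary[OF dom that diff grad0 cont bnd(1)]
      constant_from_boundary[OF dom that diff grad1 cont bnd(2)] by blast+
  have div: "(fpx (velx F') z + fpy (vely F') z) $ 0 = 0"
    "(fpx (velx F') z + fpy (vely F') z) $ 1 = 0" if z: "z \<in> \<Omega>" for z
  proof -
    have "(pres F' z - pres F z) $ 0 = 0" "(pres F' z - pres F z) $ 1 = 0"
      using p[OF z] F(1,2)[OF z] by (simp_all add: coeff_def)
    from pressure_orders[OF step[rule_format, THEN conjunct2, THEN conjunct2, THEN conjunct2, OF z]
        this old_grad[OF z] F(3,4)[OF z] nz(1,3)]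
    show "(fpx (velx F') z + fpy (vely F') z) $ 0 = 0"
      "(fpx (velx F') z + fpy (vely F') z) $ 1 = 0" .
  qed
  show "compatible \<Omega> pbar0 pbar1 F'"
    unfolding compatible_def using p div by (simp add: fpx_def fpy_def)
  fix z assume z: "z \<in> \<Omega>"
  have pos: "coeff 0 (dens F) z \<noteq> 0" "R $ 0 \<noteq> 0"
    using r0[OF z] nz(4) by (simp_all add: coeff_def)
  have split: "(rmax - r) / (r * rmax) = inverse r - inverse rmax"
    if "r \<noteq> 0" "rmax \<noteq> 0" for r rmax :: real
    using that by (simp add: field_simps)
  have mass: "(coeff 0 (dens F') z - coeff 0 (dens F) z) / D $ 0
      + (px (\<lambda>w. coeff 0 (dens F) w * coeff 0 (velx F) w) z
        + py (\<lambda>w. coeff 0 (dens F) w * coeff 0 (vely F) w) z) = 0"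
    using arg_cong[OF step[rule_format, THEN conjunct1, OF z], of "\<lambda>f. f $ 0"] nz(2)
    by (simp add: coeff_def fpx_def fpy_def)
  have velx: "(coeff 0 (velx F') z - coeff 0 (velx F) z) / D $ 0
      + (coeff 0 (velx F) z * px (coeff 0 (velx F)) z + coeff 0 (vely F) z * py (coeff 0 (velx F)) z)
      + (inverse (coeff 0 (dens F) z) - inverse (R $ 0)) * px (coeff 2 (pres F)) z
      + inverse (R $ 0) * px (coeff 2 (pres F')) z = 0"
    using momx(3)[OF z z z] by (simp add: fpx_def fpy_def coeff_def divide_inverse)
  have vely: "(coeff 0 (vely F') z - coeff 0 (vely F) z) / D $ 0
      + (coeff 0 (velx F) z * px (coeff 0 (vely F)) z + coeff 0 (vely F) z * py (coeff 0 (vely F)) z)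
      + (inverse (coeff 0 (dens F) z) - inverse (R $ 0)) * py (coeff 2 (pres F)) z
      + inverse (R $ 0) * py (coeff 2 (pres F')) z = 0"
    using momy(3)[OF z z z] by (simp add: fpx_def fpy_def coeff_def divide_inverse)
  show "limit_discretization \<Omega> pbar0 pbar1 (D $ 0) (leading_coeffs F) (leading_coeffs F') z = 0"
    unfolding limit_discretization_def leading_coeffs_def limit_state.simps Let_def zero_prod_def
      R[symmetric]
    unfolding split[OF pos]
    using mass velx vely p[OF z] div[OF z] by (simp add: fpx_def fpy_def inverse_eq_divide)
qed

section \<open>The asymptotic preserving property\<close>

theorem theorem3p1:
  fixes \<Omega> :: "(real \<times> real) set"
    and \<gamma> K \<Delta>x \<Delta>y pbar0 pbar1 :: real
  assumes "open \<Omega>" and "connected \<Omega>" and "bounded \<Omega>" and "\<Omega> \<noteq> {}"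
    and "dirichlet_solvable \<Omega>"
    and "\<gamma> > 0" and "K > 0" and "\<Delta>x > 0" and "\<Delta>y > 0" and "pbar0 > 0"
  shows "asymptotic_preserving \<Omega> pbar0 pbar1
           (cfl_time_step \<Omega> \<gamma> K \<Delta>x \<Delta>y) (semi_implicit_step \<Omega> \<gamma>)
           (limit_discretization \<Omega> pbar0 pbar1)"
  unfolding asymptotic_preserving_def
proof (intro conjI allI impI)
  show "consistent_discretization \<Omega> pbar0 pbar1 (limit_discretization \<Omega> pbar0 pbar1)"
    by (rule limit_discretization_consistent[OF assms(1,3,4)])
next
  fix W F dt R Q D B
  assume "old_time_data \<Omega> pbar0 pbar1 W F \<and>
    (\<forall>\<^sub>F e in at_right 0. ereal (dt e) = cfl_time_step \<Omega> \<gamma> K \<Delta>x \<Delta>y e (W e)) \<and>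
    expansion (\<lambda>e. rho_max \<Omega> (W e)) R \<and> expansion (\<lambda>e. p_min \<Omega> (W e)) Q \<and>
    expansion dt D \<and> boundary_data \<Omega> pbar0 pbar1 B"
  then have old: "old_time_data \<Omega> pbar0 pbar1 W F"
    and dt: "\<forall>\<^sub>F e in at_right 0. ereal (dt e) = cfl_time_step \<Omega> \<gamma> K \<Delta>x \<Delta>y e (W e)"
    and R: "expansion (\<lambda>e. rho_max \<Omega> (W e)) R" and Q: "expansion (\<lambda>e. p_min \<Omega> (W e)) Q"
    and D: "expansion dt D" and B: "boundary_data \<Omega> pbar0 pbar1 B"
    by blast+
  note R0 = rho_max_leading[OF assms(1,3,4) old R]
  have D0: "0 < D $ 0"
    by (rule time_step_nondegenerate[OF assms(1,3,4) old assms(6-9) dt D])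
  then show "0 < fps_nth D 0" .
  have Q0: "Q $ 0 = pbar0"
    by (rule p_min_leading[OF assms(1,3,4) old Q])
  have nz: "\<gamma> \<noteq> 0" "D $ 0 \<noteq> 0" "Q $ 0 \<noteq> 0" "R $ 0 \<noteq> 0"
    using assms(6,10) D0 Q0 R0(2) by simp_all
  show "\<exists>F'. new_time_expansion \<Omega> B (semi_implicit_step \<Omega> \<gamma> R Q D F) F'"
    by (rule new_time_expansion_exists[OF assms(1,5) old B nz(1,4,3,2)])
  fix F'
  assume new: "new_time_expansion \<Omega> B (semi_implicit_step \<Omega> \<gamma> R Q D F) F'"
  note limit = new_time_expansion_limit[OF assms(1-3) old B nz R0(1) new]
  show "compatible \<Omega> pbar0 pbar1 F'"
    by (rule limit(1))
  show "\<forall>z\<in>\<Omega>. limit_discretization \<Omega> pbar0 pbar1 (fps_nth D 0)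
      (leading_coeffs F) (leading_coeffs F') z = 0"
    using limit(2) by blast
qed

end
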